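(* Let $X$ be a non-negative random variable with distribution $F_X$ such that $\mathbb{E}[\log(1+\lambda X)]<\infty$ for all $\lambda>0$. Let $\theta>0$ and $0<\sigma\le 1$, let $Y_\sigma$ be a Bernoulli random variable with success probability $\sigma$ independent of $X$, and let $\beta_{\theta\sigma,\theta(1-\sigma)}$ be a beta random variable with parameters $(\theta\sigma,\theta(1-\sigma))$ independent of the Dirichlet mean $M_{\theta\sigma}(F_X)$. Then: (i) $\beta_{\theta\sigma,\theta(1-\sigma)}\,M_{\theta\sigma}(F_X)\overset{d}{=}M_\theta(F_{XY_\sigma})$. (ii) Equivalently, $M_\theta(F_{Y_\sigma})\,M_{\theta\sigma}(F_X)\overset{d}{=}M_\theta(F_{XY_\sigma})$. (iii) $G_{\theta\sigma}M_{\theta\sigma}(F_X)\overset{d}{=}G_\theta M_\theta(F_{XY_\sigma})$. (iv) That is, the distributions $\mathrm{GGC}(\theta\sigma,F_X)$ and $\mathrm{GGC}(\theta,F_{XY_\sigma})$ coincide.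
   Context: $F_R$ denotes the distribution of a random variable $R$. In particular $F_{XY_\sigma}(dx)=\sigma F_X(dx)+(1-\sigma)\delta_0(dx)$. Dirichlet process and Dirichlet mean: for $\theta>0$ and a probability distribution $F$ on $[0,\infty)$, a Dirichlet process $P_\theta$ with total mass $\theta$ and parameter $F$ is a random probability measure on $[0,\infty)$ such that for every finite measurable partition $(C_1,\dots,C_k)$ of $[0,\infty)$ the vector $(P_\theta(C_1),\dots,P_\theta(C_k))$ is Dirichlet distributed with parameters $(\theta F(C_1),\dots,\theta F(C_k))$. The Dirichlet mean is $M_\theta(F)\overset{d}{=}\int_0^\infty x\,P_\theta(dx)$; it is (a.s.) finite if and only if $\int_0^\infty\log(1+\lambda x)F(dx)<\infty$ for $\lambda>0$. $G_a$ denotes a gamma$(a,1)$ random variable. $\mathrm{GGC}(\theta,F)$ denotes the law of $G_\theta M_\theta(F)$, with $G_\theta$ independent of $M_\theta(F)$; its Laplace transform at $\lambda\ge0$ is $\exp(-\theta\int_0^\infty\log(1+\lambda x)F(dx))$. Conventions: in all products of random variables the factors are independent; $\beta_{\theta,0}:=1$ (the case $\sigma=1$). *)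

theory Defs
  imports "HOL-Probability.Probability"
begin

text \<open>
  Laws of real random variables are measures on \<^term>\<open>borel :: real measure\<close>. The degenerate
  case \<open>a = 0\<close> (point mass at 0) is the usual convention that lets a Dirichlet vector have
  vanishing parameters; it is needed for cells of a partition that have \<open>F\<close>-measure 0.
\<close>

definition gamma_law :: "real \<Rightarrow> real measure" where
  "gamma_law a =
     (if a = 0 then return borel 0
      else density lborel
        (\<lambda>x. ennreal (indicator {0<..} x * (x powr (a - 1) * exp (- x) / Gamma a))))"

text \<open>The case \<open>b = 0\<close> is the convention that a beta variable with parameters \<open>(a, 0)\<close> is 1.\<close>

definition beta_law :: "real \<Rightarrow> real \<Rightarrow> real measure" where
  "beta_law a b =
     (if b = 0 then return borel 1
      else density lborel
        (\<lambda>x. ennreal (indicator {0<..<1} x *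
               (x powr (a - 1) * (1 - x) powr (b - 1) / Beta a b))))"

definition bernoulli_law :: "real \<Rightarrow> real measure" where
  "bernoulli_law p = distr (measure_pmf (bernoulli_pmf p)) borel of_bool"

text \<open>
  The Dirichlet law with parameters \<open>\<alpha> 0, \<dots>, \<alpha> (k - 1) \<ge> 0\<close>, not all zero, is the law
  of a vector of independent gamma variables divided by its sum.
\<close>

definition dirichlet_law :: "nat \<Rightarrow> (nat \<Rightarrow> real) \<Rightarrow> (nat \<Rightarrow> real) measure" where
  "dirichlet_law k \<alpha> =
     distr (PiM {..<k} (\<lambda>i. gamma_law (\<alpha> i))) (PiM {..<k} (\<lambda>_. borel))
       (\<lambda>g. \<lambda>i\<in>{..<k}. g i / (\<Sum>j<k. g j))"

definition nonneg_borel :: "real measure" where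
  "nonneg_borel = restrict_space borel {0..}"

text \<open>
  \<open>P\<close> is a random probability measure on \<open>[0, \<infinity>)\<close>, defined on the probability space \<open>W\<close>.
  The parameter \<open>F\<close> is the law on the reals of an almost surely non-negative random variable.
  The cells \<open>C i\<close> may be empty.
\<close>

definition dirichlet_process ::
    "'w measure \<Rightarrow> real \<Rightarrow> real measure \<Rightarrow> ('w \<Rightarrow> real measure) \<Rightarrow> bool" where
  "dirichlet_process W \<theta> F P \<longleftrightarrow>
     prob_space W \<and>
     P \<in> W \<rightarrow>\<^sub>M prob_algebra nonneg_borel \<and>
     (\<forall>k C. (\<forall>i<k. C i \<in> sets nonneg_borel) \<and> disjoint_family_on C {..<k} \<and>
            (\<Union>i<k. C i) = {0..} \<longrightarrow>
        distr W (PiM {..<k} (\<lambda>_. borel)) (\<lambda>w. \<lambda>i\<in>{..<k}. measure (P w) (C i))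
          = dirichlet_law k (\<lambda>i. \<theta> * measure F (C i)))"

text \<open>
  \<open>M\<close> is a (real-valued, non-negative) version of the Dirichlet mean: it has the same law as
  the integral of \<open>x\<close> with respect to a Dirichlet process. The two are compared in the extended
  half-line because the integral may be infinite on a null set. Taking
  the process on a space of type \<^typ>\<open>real measure measure\<close> loses no generality: any Dirichlet
  process may be replaced by the identity map under its own law.
\<close>

definition dirichlet_mean ::
    "'a measure \<Rightarrow> real \<Rightarrow> real measure \<Rightarrow> ('a \<Rightarrow> real) \<Rightarrow> bool" where
  "dirichlet_mean \<Omega> \<theta> F M \<longleftrightarrow>
     M \<in> borel_measurable \<Omega> \<and> (AE \<omega> in \<Omega>. 0 \<le> M \<omega>) \<and>
     (\<exists>(W :: real measure measure) P. dirichlet_process W \<theta> F P \<and>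
        distr \<Omega> borel (\<lambda>\<omega>. ennreal (M \<omega>)) = distr W borel (\<lambda>w. \<integral>\<^sup>+x. ennreal x \<partial>P w))"

text \<open>
  The law of the product of independent gamma and Dirichlet mean variables. It depends only on
  the laws of the two factors, so realising the pair on a space of type
  \<^typ>\<open>(real \<times> real) measure\<close> is no restriction, and the description is unique.
\<close>

definition GGC :: "real \<Rightarrow> real measure \<Rightarrow> real measure" where
  "GGC \<theta> F =
     (THE L. \<exists>(\<Omega> :: (real \<times> real) measure) G M.
        prob_space \<Omega> \<and> G \<in> borel_measurable \<Omega> \<and> distr \<Omega> borel G = gamma_law \<theta> \<and>
        dirichlet_mean \<Omega> \<theta> F M \<and> prob_space.indep_var \<Omega> borel G borel M \<and>
        L = distr \<Omega> borel (\<lambda>\<omega>. G \<omega> * M \<omega>))"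

end

theory Submission
  imports Defs
begin

text \<open>
  A Dirichlet vector with parameters \<open>\<alpha> i\<close> is a vector of independent gamma variables \<open>g i\<close> divided by
  their sum \<open>S\<close>, and a Dirichlet mean is a limit of linear combinations \<open>m / S\<close> of such vectors, where
  \<open>m = \<Sum> v i * g i\<close> and \<open>v i\<close> approximates the values of \<open>x\<close> on the \<open>i\<close>-th cell of a partition.
  Everything rests on two facts about gamma variables: \<open>m / S\<close> is independent of \<open>S\<close>
  (\<open>gamma_ratio_indep_sum\<close>), and \<open>S / (S + y)\<close> is a beta variable when \<open>y\<close> is a further independent gamma
  variable (\<open>beta_gamma_algebra\<close>). Together they say that a beta variable times \<open>m / S\<close> has the law of
  \<open>m / (S + y)\<close>.

  Now \<open>y\<close> may be added to the coordinate of the cell that contains 0: there \<open>x\<close> is approximated by 0, so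
  the numerator does not change, while the denominator becomes \<open>S + y\<close>. Hence multiplying a Dirichlet
  mean by a beta variable with parameters \<open>(a, b)\<close> amounts to adding mass \<open>b\<close> at 0 to a parameter
  measure of total mass \<open>a\<close> (\<open>beta_times_dirichlet_combination\<close> for finite partitions,
  \<open>dirichlet_mean_beta_scaling\<close> in the limit). For \<open>a = \<theta> * \<sigma>\<close> and \<open>b = \<theta> * (1 - \<sigma>)\<close> this is exactly
  the passage from \<open>\<theta> * \<sigma>\<close> times the law of \<open>X\<close> to \<open>\<theta>\<close> times the law of \<open>X * Y\<close>, which is the first
  identity.

  The other identities follow from the same statement. For the constant 1 in place of \<open>X\<close> it says that
  the Dirichlet mean of the Bernoulli law is the beta variable in question. Multiplying both sides by an
  independent gamma variable of parameter \<open>\<theta>\<close> gives the third identity, because gamma times beta is gamma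
  (\<open>gamma_times_beta\<close>). Finally, with \<open>b = 0\<close> it says that the law of a Dirichlet mean is determined by
  its parameters, so that \<open>GGC\<close> is well defined (\<open>GGC_eq\<close>) and the third identity becomes the
  fourth.
\<close>

section \<open>Gamma and beta laws\<close>

lemma sets_gamma_law [simp, measurable_cong]: "sets (gamma_law a) = sets borel"
  by (simp add: gamma_law_def)

lemma space_gamma_law [simp]: "space (gamma_law a) = UNIV"
  by (simp add: gamma_law_def)

lemma sets_beta_law [simp, measurable_cong]: "sets (beta_law a b) = sets borel"
  by (simp add: beta_law_def)

lemma space_beta_law [simp]: "space (beta_law a b) = UNIV"
  by (simp add: beta_law_def)

lemma nn_integral_gamma_law:
  assumes "a \<noteq> 0" and [measurable]: "f \<in> borel_measurable borel"
  shows "(\<integral>\<^sup>+x. f x \<partial>gamma_law a) =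
    (\<integral>\<^sup>+x. ennreal (indicator {0<..} x * (x powr (a - 1) * exp (- x) / Gamma a)) * f x \<partial>lborel)"
  using assms(1) by (simp add: gamma_law_def nn_integral_density)

lemma nn_integral_beta_law:
  assumes "b \<noteq> 0" and [measurable]: "f \<in> borel_measurable borel"
  shows "(\<integral>\<^sup>+x. f x \<partial>beta_law a b) =
    (\<integral>\<^sup>+x. ennreal (indicator {0<..<1} x * (x powr (a - 1) * (1 - x) powr (b - 1) / Beta a b)) * f x \<partial>lborel)"
  using assms(1) by (simp add: beta_law_def nn_integral_density)

lemma prob_space_gamma_law:
  assumes "0 \<le> a" shows "prob_space (gamma_law a)"
proof (cases "a = 0")
  case True
  then show ?thesis by (simp add: gamma_law_def prob_space_return)
next
  case False
  with assms have a: "0 < a" by simp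
  have "(\<integral>\<^sup>+x. 1 \<partial>gamma_law a) =
      (\<integral>\<^sup>+x. ennreal (indicator {0<..} x * (x powr (a - 1) * exp (- x) / Gamma a)) \<partial>lborel)"
    using False by (subst nn_integral_gamma_law) auto
  also have "\<dots> = (\<integral>\<^sup>+x. ennreal (1 / Gamma a) * ennreal (indicator {0..} x * x powr (a - 1) / exp x) \<partial>lborel)"
    using a by (intro nn_integral_cong_AE AE_I[where N="{0}"])
      (auto simp: indicator_def exp_minus field_simps Gamma_real_pos simp flip: ennreal_mult'' split: if_splits)
  also have "\<dots> = ennreal (1 / Gamma a) * ennreal (Gamma a)"
    using a by (subst nn_integral_cmult) (auto simp: Gamma_conv_nn_integral_real)
  also have "\<dots> = 1"
    using Gamma_real_pos[OF a] by (simp flip: ennreal_mult'')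
  finally show ?thesis by (intro prob_spaceI) simp
qed

lemma product_sigma_finite_gamma_law:
  assumes "\<And>i. 0 \<le> \<alpha> i"
  shows "product_sigma_finite (\<lambda>i. gamma_law (\<alpha> i))"
  by standard (metis assms prob_space_gamma_law prob_space_imp_sigma_finite sigma_finite_measure.sigma_finite_countable)
lemma AE_gamma_law_pos:
  assumes "a \<noteq> 0" shows "AE x in gamma_law a. 0 < x"
  unfolding gamma_law_def using assms by (simp add: AE_density indicator_def)

lemma AE_gamma_law_nonneg: "AE x in gamma_law a. 0 \<le> x"
  unfolding gamma_law_def by (cases "a = 0") (simp_all add: AE_density AE_return indicator_def)

lemma ennreal_mult3:
  assumes "0 \<le> p" "0 \<le> q"
  shows "ennreal t * (ennreal p * (ennreal q * F)) = ennreal (t * (p * q)) * F"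
  using assms by (simp add: ennreal_mult'' mult.assoc)

text \<open>
  The measure \<open>x powr (a - 1) dx\<close> on the positive half-line is homogeneous of degree \<open>a\<close>, so a
  dilation changes the gamma law only by a power of \<open>t\<close> and a tilt of the exponential factor.
  The point mass at 0 (\<open>a = 0\<close>), which cells of measure zero produce, obeys the same formula.
\<close>
lemma gamma_law_scale:
  fixes f :: "real \<Rightarrow> ennreal"
  assumes a: "0 \<le> a" and t: "0 < t" and [measurable]: "f \<in> borel_measurable borel"
  shows "(\<integral>\<^sup>+x. f (t * x) \<partial>gamma_law a)
       = (\<integral>\<^sup>+x. ennreal (t powr (- a) * exp ((1 - 1 / t) * x)) * f x \<partial>gamma_law a)"
proof (cases "a = 0")
  case True
  then show ?thesis using t by (simp add: gamma_law_def nn_integral_return)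
next
  case False
  with a have a: "0 < a" by simp
  let ?d = "\<lambda>x. indicator {0<..} x * (x powr (a - 1) * exp (- x) / Gamma a)"
  let ?w = "\<lambda>x. t powr (- a) * exp ((1 - 1 / t) * x)"
  have "(\<integral>\<^sup>+x. ennreal (?w x) * f x \<partial>gamma_law a) = (\<integral>\<^sup>+x. ennreal (?d x) * (ennreal (?w x) * f x) \<partial>lborel)"
    using False by (subst nn_integral_gamma_law) auto
  also have "\<dots> = ennreal \<bar>t\<bar> * (\<integral>\<^sup>+x. ennreal (?d (0 + t * x)) * (ennreal (?w (0 + t * x)) * f (0 + t * x)) \<partial>lborel)"
    using t by (intro nn_integral_real_affine) auto
  also have "\<dots> = (\<integral>\<^sup>+x. ennreal t * (ennreal (?d (t * x)) * (ennreal (?w (t * x)) * f (t * x))) \<partial>lborel)"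
    using t by (subst nn_integral_cmult) auto
  also have "\<dots> = (\<integral>\<^sup>+x. ennreal (?d x) * f (t * x) \<partial>lborel)"
  proof (rule nn_integral_cong)
    fix x :: real
    have eq: "t * (?d (t * x) * ?w (t * x)) = ?d x"
    proof (cases "0 < x")
      case True
      have "exp (- (t * x)) * exp (t * x - x) = exp (- x)" by (simp flip: exp_add)
      moreover have "t * (t powr (a - 1) * t powr (- a)) = 1"
        using t by (simp add: powr_minus powr_diff)
      moreover have "t * (?d (t * x) * ?w (t * x)) = (t * (t powr (a - 1) * t powr (- a))) * (x powr (a - 1)) *
          (exp (- (t * x)) * exp (t * x - x)) / Gamma a"
        using True t by (simp add: powr_mult field_simps)
      ultimately show ?thesis using True by simp
    next
      case False
      then show ?thesis using t by (simp add: indicator_def zero_less_mult_iff)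
    qed
    have nonneg: "0 \<le> ?d (t * x)" using Gamma_real_pos[OF a] by simp
    show "ennreal t * (ennreal (?d (t * x)) * (ennreal (?w (t * x)) * f (t * x))) = ennreal (?d x) * f (t * x)"
      by (subst ennreal_mult3) (use nonneg t in simp, use t in simp, simp only: eq)
  qed
  also have "\<dots> = (\<integral>\<^sup>+x. f (t * x) \<partial>gamma_law a)"
    using False by (subst nn_integral_gamma_law) auto
  finally show ?thesis ..
qed

text \<open>
  The product of gamma laws inherits the homogeneity, and its exponential tilt depends on the vector
  \<open>g\<close> only through its sum. Recording \<open>g\<close> by the pair of a linear form and the sum is all that is
  required of it, and lets the induction add one coordinate by a translation of the pair.
\<close>
lemma PiM_gamma_law_scale:
  fixes f :: "real \<times> real \<Rightarrow> ennreal" and \<alpha> v :: "'i \<Rightarrow> real"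
  assumes "finite I" and \<alpha>: "\<And>i. 0 \<le> \<alpha> i" and t: "0 < t"
    and "f \<in> borel_measurable (borel \<Otimes>\<^sub>M borel)"
  shows "(\<integral>\<^sup>+g. f (t * (\<Sum>i\<in>I. v i * g i), t * (\<Sum>i\<in>I. g i)) \<partial>PiM I (\<lambda>i. gamma_law (\<alpha> i)))
       = (\<integral>\<^sup>+g. ennreal (t powr (- sum \<alpha> I) * exp ((1 - 1 / t) * (\<Sum>i\<in>I. g i))) *
            f (\<Sum>i\<in>I. v i * g i, \<Sum>i\<in>I. g i) \<partial>PiM I (\<lambda>i. gamma_law (\<alpha> i)))"
  using assms(1,4)
proof (induction I arbitrary: f rule: finite_induct)
  case empty
  interpret product_sigma_finite "\<lambda>i. gamma_law (\<alpha> i)"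
    by (rule product_sigma_finite_gamma_law[OF \<alpha>])
  show ?case using t by (simp add: nn_integral_empty)
next
  case (insert j I)
  interpret product_sigma_finite "\<lambda>i. gamma_law (\<alpha> i)"
    by (rule product_sigma_finite_gamma_law[OF \<alpha>])
  interpret J: prob_space "gamma_law (\<alpha> j)" by (rule prob_space_gamma_law[OF \<alpha>])
  note [measurable] = insert.prems
  let ?w = "\<lambda>b y. t powr (- b) * exp ((1 - 1 / t) * y)"
  let ?N = "PiM I (\<lambda>i. gamma_law (\<alpha> i))"
  let ?m = "\<lambda>x. \<Sum>i\<in>I. v i * x i" and ?s = "\<lambda>x. \<Sum>i\<in>I. x i"
  have upd: "(\<Sum>i\<in>insert j I. v i * (x(j := y)) i) = v j * y + ?m x"
    "(\<Sum>i\<in>insert j I. (x(j := y)) i) = y + ?s x" for x y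
    using insert.hyps by (auto intro!: sum.cong arg_cong2[where f="(+)"])
  have "(\<integral>\<^sup>+g. f (t * (\<Sum>i\<in>insert j I. v i * g i), t * (\<Sum>i\<in>insert j I. g i)) \<partial>PiM (insert j I) (\<lambda>i. gamma_law (\<alpha> i)))
      = (\<integral>\<^sup>+x. \<integral>\<^sup>+y. f (t * (v j * y + ?m x), t * (y + ?s x)) \<partial>gamma_law (\<alpha> j) \<partial>?N)"
    using insert.hyps by (subst product_nn_integral_insert) (simp_all only: upd, auto)
  also have "\<dots> = (\<integral>\<^sup>+x. \<integral>\<^sup>+y. ennreal (?w (\<alpha> j) y) * f (v j * y + t * ?m x, y + t * ?s x) \<partial>gamma_law (\<alpha> j) \<partial>?N)"
  proof (rule nn_integral_cong)
    fix x
    have "(\<integral>\<^sup>+y. f (v j * (t * y) + t * ?m x, t * y + t * ?s x) \<partial>gamma_law (\<alpha> j)) =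
        (\<integral>\<^sup>+y. ennreal (?w (\<alpha> j) y) * f (v j * y + t * ?m x, y + t * ?s x) \<partial>gamma_law (\<alpha> j))"
      using \<alpha> t by (intro gamma_law_scale[where f="\<lambda>y. f (v j * y + t * ?m x, y + t * ?s x)"]) auto
    then show "(\<integral>\<^sup>+y. f (t * (v j * y + ?m x), t * (y + ?s x)) \<partial>gamma_law (\<alpha> j)) =
        (\<integral>\<^sup>+y. ennreal (?w (\<alpha> j) y) * f (v j * y + t * ?m x, y + t * ?s x) \<partial>gamma_law (\<alpha> j))"
      by (simp add: algebra_simps)
  qed
  also have "\<dots> = (\<integral>\<^sup>+x. ennreal (?w (sum \<alpha> I) (?s x)) *
      (\<integral>\<^sup>+y. ennreal (?w (\<alpha> j) y) * f (v j * y + ?m x, y + ?s x) \<partial>gamma_law (\<alpha> j)) \<partial>?N)"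
    using insert.IH[of "\<lambda>p. \<integral>\<^sup>+y. ennreal (?w (\<alpha> j) y) * f (v j * y + fst p, y + snd p) \<partial>gamma_law (\<alpha> j)"]
    by simp
  also have "\<dots> = (\<integral>\<^sup>+x. \<integral>\<^sup>+y. ennreal (?w (sum \<alpha> (insert j I)) (y + ?s x)) * f (v j * y + ?m x, y + ?s x)
      \<partial>gamma_law (\<alpha> j) \<partial>?N)"
  proof (rule nn_integral_cong)
    fix x
    have w: "?w (sum \<alpha> I) (?s x) * ?w (\<alpha> j) y = ?w (sum \<alpha> (insert j I)) (y + ?s x)" for y
      using insert.hyps t by (simp add: powr_diff powr_minus field_simps ring_distribs flip: exp_add)
    show "ennreal (?w (sum \<alpha> I) (?s x)) *
        (\<integral>\<^sup>+y. ennreal (?w (\<alpha> j) y) * f (v j * y + ?m x, y + ?s x) \<partial>gamma_law (\<alpha> j))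
      = (\<integral>\<^sup>+y. ennreal (?w (sum \<alpha> (insert j I)) (y + ?s x)) * f (v j * y + ?m x, y + ?s x) \<partial>gamma_law (\<alpha> j))"
      unfolding w[symmetric]
      by (subst nn_integral_cmult[symmetric]) (auto simp: ennreal_mult mult.assoc)
  qed
  also have "\<dots> = (\<integral>\<^sup>+g. ennreal (?w (sum \<alpha> (insert j I)) (\<Sum>i\<in>insert j I. g i)) *
      f (\<Sum>i\<in>insert j I. v i * g i, \<Sum>i\<in>insert j I. g i) \<partial>PiM (insert j I) (\<lambda>i. gamma_law (\<alpha> i)))"
    using insert.hyps by (subst product_nn_integral_insert) (simp_all only: upd, auto)
  finally show ?case .
qed

text \<open>
  If \<open>x\<close> and \<open>y\<close> are independent gamma variables with parameters \<open>a\<close> and \<open>b\<close>, then \<open>x + y\<close> and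
  \<open>x / (x + y)\<close> are independent, with the gamma law of parameter \<open>a + b\<close> and a beta law: in the
  coordinates \<open>s = x + y\<close> and \<open>r = x / s\<close> the joint density factorises. The change of coordinates is
  a translation in \<open>y\<close> followed by a dilation in \<open>x\<close>, with an exchange of integrals in between.
\<close>
lemma beta_gamma_algebra:
  fixes f :: "real \<times> real \<Rightarrow> ennreal"
  assumes a: "0 < a" and b: "0 \<le> b" and [measurable]: "f \<in> borel_measurable (borel \<Otimes>\<^sub>M borel)"
  shows "(\<integral>\<^sup>+x. \<integral>\<^sup>+y. f (x + y, x / (x + y)) \<partial>gamma_law b \<partial>gamma_law a)
       = (\<integral>\<^sup>+s. \<integral>\<^sup>+r. f (s, r) \<partial>beta_law a b \<partial>gamma_law (a + b))"
proof (cases "b = 0")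
  case True
  have "AE x in gamma_law a. f (x, x / x) = f (x, 1)"
    using AE_gamma_law_pos[of a, OF less_imp_neq[OF a, symmetric]] by eventually_elim simp
  then show ?thesis
    using True by (auto simp: gamma_law_def[of 0] beta_law_def nn_integral_return intro!: nn_integral_cong_AE)
next
  case False
  with b have b: "0 < b" by simp
  have G: "0 < Gamma a" "0 < Gamma b" "0 < Gamma (a + b)"
    using a b by (auto intro: Gamma_real_pos)
  let ?d = "\<lambda>c x. indicator {0<..} x * (x powr (c - 1) * exp (- x) / Gamma c)"
  let ?e = "\<lambda>r. indicator {0<..<1} r * (r powr (a - 1) * (1 - r) powr (b - 1) / Beta a b)"
  have "(\<integral>\<^sup>+x. \<integral>\<^sup>+y. f (x + y, x / (x + y)) \<partial>gamma_law b \<partial>gamma_law a)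
      = (\<integral>\<^sup>+x. ennreal (?d a x) * (\<integral>\<^sup>+y. ennreal (?d b y) * f (x + y, x / (x + y)) \<partial>lborel) \<partial>lborel)"
    using a b by (simp add: nn_integral_gamma_law)
  also have "\<dots> = (\<integral>\<^sup>+x. \<integral>\<^sup>+s. ennreal (?d a x) * (ennreal (?d b (s - x)) * f (s, x / s)) \<partial>lborel \<partial>lborel)"
  proof (rule nn_integral_cong)
    fix x :: real
    have "(\<integral>\<^sup>+y. ennreal (?d b y) * f (x + y, x / (x + y)) \<partial>lborel)
        = (\<integral>\<^sup>+s. ennreal (?d b (s - x)) * f (s, x / s) \<partial>lborel)"
      using nn_integral_real_affine[of "\<lambda>y. ennreal (?d b y) * f (x + y, x / (x + y))" 1 "- x"]
      by (simp add: ac_simps)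
    then show "ennreal (?d a x) * (\<integral>\<^sup>+y. ennreal (?d b y) * f (x + y, x / (x + y)) \<partial>lborel)
      = (\<integral>\<^sup>+s. ennreal (?d a x) * (ennreal (?d b (s - x)) * f (s, x / s)) \<partial>lborel)"
      by (simp add: nn_integral_cmult)
  qed
  also have "\<dots> = (\<integral>\<^sup>+s. \<integral>\<^sup>+x. ennreal (?d a x) * (ennreal (?d b (s - x)) * f (s, x / s)) \<partial>lborel \<partial>lborel)"
    by (rule lborel_pair.Fubini'[symmetric]) measurable
  also have "\<dots> = (\<integral>\<^sup>+s. ennreal (?d (a + b) s) * (\<integral>\<^sup>+r. ennreal (?e r) * f (s, r) \<partial>lborel) \<partial>lborel)"
  proof (rule nn_integral_cong)
    fix s :: real
    show "(\<integral>\<^sup>+x. ennreal (?d a x) * (ennreal (?d b (s - x)) * f (s, x / s)) \<partial>lborel)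
        = ennreal (?d (a + b) s) * (\<integral>\<^sup>+r. ennreal (?e r) * f (s, r) \<partial>lborel)"
    proof (cases "0 < s")
      case False
      then have "(\<integral>\<^sup>+x. ennreal (?d a x) * (ennreal (?d b (s - x)) * f (s, x / s)) \<partial>lborel) = (\<integral>\<^sup>+x. 0 \<partial>(lborel :: real measure))"
        by (intro nn_integral_cong) (simp add: indicator_def)
      with False show ?thesis by simp
    next
      case s: True
      have eq: "s * (?d a (s * r) * ?d b (s - s * r)) = ?d (a + b) s * ?e r" for r
      proof (cases "0 < r \<and> r < 1")
        case True
        then have "s - s * r = s * (1 - r)" "0 < s * r" "0 < s * (1 - r)" using s by (simp_all add: algebra_simps)
        moreover have "s * (s powr (a - 1) * s powr (b - 1)) = s powr (a + b - 1)"
          using s by (simp add: powr_diff powr_add)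
        moreover have "exp (- (s * r)) * exp (- (s * (1 - r))) = exp (- s)"
          by (simp flip: exp_add add: algebra_simps)
        moreover have "s * (?d a (s * r) * ?d b (s * (1 - r))) =
            (s * (s powr (a - 1) * s powr (b - 1))) * (exp (- (s * r)) * exp (- (s * (1 - r)))) *
            (r powr (a - 1) * (1 - r) powr (b - 1)) / (Gamma a * Gamma b)"
          using True s by (simp add: powr_mult)
        ultimately show ?thesis
          using True s G by (simp add: Beta_def)
      next
        case False
        then have "\<not> (0 < s * r \<and> 0 < s - s * r)"
          using s zero_less_mult_iff[of s r] zero_less_mult_iff[of s "1 - r"] by (auto simp: right_diff_distrib)
        then have "?d a (s * r) * ?d b (s - s * r) = 0"
          by (cases "0 < s * r") (simp_all add: indicator_def)
        moreover have "?e r = 0" using False by (auto simp: indicator_def)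
        ultimately show ?thesis by (simp only: mult_zero_right)
      qed
      have nn: "0 \<le> ?d a x" "0 \<le> ?d b x" "0 \<le> ?d (a + b) x" "0 \<le> ?e x" for x
        using G by (auto simp: Beta_def)
      have "(\<integral>\<^sup>+x. ennreal (?d a x) * (ennreal (?d b (s - x)) * f (s, x / s)) \<partial>lborel) =
          ennreal \<bar>s\<bar> * (\<integral>\<^sup>+r. ennreal (?d a (0 + s * r)) * (ennreal (?d b (s - (0 + s * r))) * f (s, (0 + s * r) / s)) \<partial>lborel)"
        using s by (intro nn_integral_real_affine) auto
      also have "\<dots> = (\<integral>\<^sup>+r. ennreal s * (ennreal (?d a (s * r)) * (ennreal (?d b (s - s * r)) * f (s, r))) \<partial>lborel)"
        using s by (subst nn_integral_cmult) auto
      also have "\<dots> = (\<integral>\<^sup>+r. ennreal (?d (a + b) s) * (ennreal (?e r) * f (s, r)) \<partial>lborel)"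
        by (simp only: ennreal_mult3[OF nn(1,2)] eq) (simp only: ennreal_mult[OF nn(3,4)] mult.assoc[where 'a=ennreal])
      also have "\<dots> = ennreal (?d (a + b) s) * (\<integral>\<^sup>+r. ennreal (?e r) * f (s, r) \<partial>lborel)"
        by (rule nn_integral_cmult) measurable
      finally show ?thesis .
    qed
  qed
  also have "\<dots> = (\<integral>\<^sup>+s. \<integral>\<^sup>+r. f (s, r) \<partial>beta_law a b \<partial>gamma_law (a + b))"
    using a b by (simp add: nn_integral_gamma_law nn_integral_beta_law)
  finally show ?thesis .
qed

lemma AE_PiM_gamma_law_sum_pos:
  fixes \<alpha> :: "'i \<Rightarrow> real"
  assumes I: "finite I" and \<alpha>: "\<And>i. 0 \<le> \<alpha> i" and pos: "0 < sum \<alpha> I"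
  shows "AE g in PiM I (\<lambda>i. gamma_law (\<alpha> i)). 0 < (\<Sum>i\<in>I. g i)"
proof -
  let ?N = "PiM I (\<lambda>i. gamma_law (\<alpha> i))"
  obtain j where j: "j \<in> I" "\<alpha> j \<noteq> 0"
    using pos by (metis less_irrefl sum.neutral)
  have "AE g in ?N. 0 < g j"
    using j \<alpha> by (intro AE_PiM_component prob_space_gamma_law AE_gamma_law_pos)
  moreover have "AE g in ?N. \<forall>i\<in>I. 0 \<le> g i"
    using I \<alpha> by (intro AE_finite_allI AE_PiM_component prob_space_gamma_law AE_gamma_law_nonneg)
  ultimately show ?thesis
    by eventually_elim (use I j in \<open>auto intro: sum_pos2\<close>)
qed

text \<open>
  A ratio \<open>\<Sum> v i * g i / \<Sum> g i\<close> of independent gamma variables is independent of the sum, and the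
  sum is again gamma distributed. The right-hand side, with \<open>u\<close> independent of \<open>g\<close>, is turned into the
  left-hand side as follows. Substitute \<open>u = r * \<Sum> g i\<close>, exchange the integrals, and absorb \<open>r\<close>
  by dilating \<open>g\<close>, which leaves the ratio unchanged and turns \<open>u\<close> into the sum itself. What remains
  is an integral over \<open>r\<close> that no longer contains \<open>f\<close>: a number \<open>K s\<close> depending on the value \<open>s\<close> of
  the sum. A dilation of \<open>r\<close> shows that \<open>K\<close> is constant, and the choice \<open>f = 1\<close> that the constant
  is 1.
\<close>
lemma gamma_ratio_indep_sum:
  fixes f :: "real \<times> real \<Rightarrow> ennreal" and \<alpha> v :: "'i \<Rightarrow> real"
  assumes I: "finite I" and \<alpha>: "\<And>i. 0 \<le> \<alpha> i" and pos: "0 < sum \<alpha> I"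
    and f [measurable]: "f \<in> borel_measurable (borel \<Otimes>\<^sub>M borel)"
  shows "(\<integral>\<^sup>+g. f ((\<Sum>i\<in>I. v i * g i) / (\<Sum>i\<in>I. g i), \<Sum>i\<in>I. g i) \<partial>PiM I (\<lambda>i. gamma_law (\<alpha> i)))
       = (\<integral>\<^sup>+g. \<integral>\<^sup>+u. f ((\<Sum>i\<in>I. v i * g i) / (\<Sum>i\<in>I. g i), u) \<partial>gamma_law (sum \<alpha> I)
            \<partial>PiM I (\<lambda>i. gamma_law (\<alpha> i)))"
proof -
  let ?N = "PiM I (\<lambda>i. gamma_law (\<alpha> i))"
  let ?m = "\<lambda>g :: 'i \<Rightarrow> real. \<Sum>i\<in>I. v i * g i" and ?s = "\<lambda>g :: 'i \<Rightarrow> real. \<Sum>i\<in>I. g i"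
  define a where "a = sum \<alpha> I"
  have a: "0 < a" using pos by (simp add: a_def)
  have Ga: "0 < Gamma a" using a by (rule Gamma_real_pos)
  interpret N: prob_space ?N
    by (intro prob_space_PiM prob_space_gamma_law \<alpha>)
  have s_pos: "AE g in ?N. 0 < ?s g"
    using I \<alpha> pos by (rule AE_PiM_gamma_law_sum_pos)
  \<comment> \<open>the integral over \<open>r\<close> that is left over after \<open>g\<close> has been dilated\<close>
  define K :: "real \<Rightarrow> ennreal" where
    "K s = (\<integral>\<^sup>+r. ennreal (indicator {0<..} r * (s powr a * r powr (- a - 1) * exp (- s / r) / Gamma a)) \<partial>lborel)" for s
  have K: "K s = K 1" if s: "0 < s" for s
  proof -
    let ?k = "\<lambda>s r. indicator {0<..} r * (s powr a * r powr (- a - 1) * exp (- s / r) / Gamma a)"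
    have "K s = ennreal \<bar>s\<bar> * (\<integral>\<^sup>+r. ennreal (?k s (0 + s * r)) \<partial>lborel)"
      unfolding K_def using s by (intro nn_integral_real_affine) auto
    also have "\<dots> = (\<integral>\<^sup>+r. ennreal s * ennreal (?k s (s * r)) \<partial>lborel)"
      using s by (subst nn_integral_cmult) auto
    also have "\<dots> = K 1"
      unfolding K_def
    proof (rule nn_integral_cong)
      fix r :: real
      have "s * ?k s (s * r) = ?k 1 r"
      proof (cases "0 < r")
        case True
        have "s * (s powr a * s powr (- a - 1)) = 1"
          using s by (simp add: powr_diff powr_minus)
        moreover have "s * ?k s (s * r) = (s * (s powr a * s powr (- a - 1))) * (r powr (- a - 1) * exp (- 1 / r) / Gamma a)"
          using True s by (simp add: powr_mult)
        ultimately show ?thesis using True by simp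
      qed (use s in \<open>simp add: indicator_def zero_less_mult_iff\<close>)
      then show "ennreal s * ennreal (?k s (s * r)) = ennreal (?k 1 r)"
        using s Ga by (simp flip: ennreal_mult)
    qed
    finally show ?thesis .
  qed
  have main: "(\<integral>\<^sup>+g. \<integral>\<^sup>+u. h (?m g / ?s g, u) \<partial>gamma_law a \<partial>?N) = (\<integral>\<^sup>+g. K 1 * h (?m g / ?s g, ?s g) \<partial>?N)"
    if [measurable]: "h \<in> borel_measurable (borel \<Otimes>\<^sub>M borel)" for h :: "real \<times> real \<Rightarrow> ennreal"
  proof -
    let ?d = "\<lambda>x. indicator {0<..} x * (x powr (a - 1) * exp (- x) / Gamma a)"
    interpret P: pair_sigma_finite ?N lborel ..
    have "(\<integral>\<^sup>+g. \<integral>\<^sup>+u. h (?m g / ?s g, u) \<partial>gamma_law a \<partial>?N)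
        = (\<integral>\<^sup>+g. \<integral>\<^sup>+r. ennreal (?s g) * (ennreal (?d (?s g * r)) * h (?m g / ?s g, ?s g * r)) \<partial>lborel \<partial>?N)"
    proof (rule nn_integral_cong_AE, use s_pos in eventually_elim)
      fix g assume s: "0 < ?s g"
      have "(\<integral>\<^sup>+u. h (?m g / ?s g, u) \<partial>gamma_law a) = (\<integral>\<^sup>+u. ennreal (?d u) * h (?m g / ?s g, u) \<partial>lborel)"
        using a by (intro nn_integral_gamma_law) auto
      also have "\<dots> = ennreal \<bar>?s g\<bar> * (\<integral>\<^sup>+r. ennreal (?d (0 + ?s g * r)) * h (?m g / ?s g, 0 + ?s g * r) \<partial>lborel)"
        using s by (intro nn_integral_real_affine) auto
      also have "\<dots> = (\<integral>\<^sup>+r. ennreal (?s g) * (ennreal (?d (?s g * r)) * h (?m g / ?s g, ?s g * r)) \<partial>lborel)"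
        using s by (subst nn_integral_cmult) auto
      finally show "(\<integral>\<^sup>+u. h (?m g / ?s g, u) \<partial>gamma_law a) =
        (\<integral>\<^sup>+r. ennreal (?s g) * (ennreal (?d (?s g * r)) * h (?m g / ?s g, ?s g * r)) \<partial>lborel)" .
    qed
    also have "\<dots> = (\<integral>\<^sup>+r. \<integral>\<^sup>+g. ennreal (?s g) * (ennreal (?d (?s g * r)) * h (?m g / ?s g, ?s g * r)) \<partial>?N \<partial>lborel)"
      by (rule P.Fubini'[symmetric]) measurable
    also have "\<dots> = (\<integral>\<^sup>+r. \<integral>\<^sup>+g. ennreal (indicator {0<..} r * (?s g powr a * r powr (- a - 1) * exp (- ?s g / r) / Gamma a)) *
        h (?m g / ?s g, ?s g) \<partial>?N \<partial>lborel)"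
    proof (rule nn_integral_cong)
      fix r :: real
      \<comment> \<open>The integrand as a function of the pair of linear form and sum of the dilated vector
        \<open>r * g\<close>; this is the form to which homogeneity applies.\<close>
      let ?H = "\<lambda>(m', s'). ennreal (s' / r) * (ennreal (?d s') * h (m' / s', s'))"
      show "(\<integral>\<^sup>+g. ennreal (?s g) * (ennreal (?d (?s g * r)) * h (?m g / ?s g, ?s g * r)) \<partial>?N)
         = (\<integral>\<^sup>+g. ennreal (indicator {0<..} r * (?s g powr a * r powr (- a - 1) * exp (- ?s g / r) / Gamma a)) *
        h (?m g / ?s g, ?s g) \<partial>?N)"
      proof (cases "0 < r")
        case r: True
        have "(\<integral>\<^sup>+g. ennreal (?s g) * (ennreal (?d (?s g * r)) * h (?m g / ?s g, ?s g * r)) \<partial>?N)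
            = (\<integral>\<^sup>+g. ?H (r * ?m g, r * ?s g) \<partial>?N)"
          using r by (simp add: mult.commute[of r])
        also have "\<dots> = (\<integral>\<^sup>+g. ennreal (r powr (- a) * exp ((1 - 1 / r) * ?s g)) * ?H (?m g, ?s g) \<partial>?N)"
          unfolding a_def using I \<alpha> r by (intro PiM_gamma_law_scale) auto
        also have "\<dots> = (\<integral>\<^sup>+g. ennreal (indicator {0<..} r * (?s g powr a * r powr (- a - 1) * exp (- ?s g / r) / Gamma a)) *
          h (?m g / ?s g, ?s g) \<partial>?N)"
        proof (rule nn_integral_cong_AE, use s_pos in eventually_elim)
          fix g assume s: "0 < ?s g"
          have "exp ((1 - 1 / r) * ?s g) * exp (- ?s g) = exp (- ?s g / r)"
            by (simp flip: exp_add add: algebra_simps)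
          moreover have "r powr (- a) / r = r powr (- a - 1)" "?s g * ?s g powr (a - 1) = ?s g powr a"
            using r s by (simp_all add: powr_diff)
          moreover have "r powr (- a) * exp ((1 - 1 / r) * ?s g) * (?s g / r * ?d (?s g))
            = (?s g * ?s g powr (a - 1)) * (r powr (- a) / r) * (exp ((1 - 1 / r) * ?s g) * exp (- ?s g)) / Gamma a"
            using s by (simp add: indicator_def)
          ultimately have eq: "r powr (- a) * exp ((1 - 1 / r) * ?s g) * (?s g / r * ?d (?s g))
            = indicator {0<..} r * (?s g powr a * r powr (- a - 1) * exp (- ?s g / r) / Gamma a)"
            using r by simp
          have "0 \<le> ?s g / r" "0 \<le> ?d (?s g)"
            using s r Ga by auto
          then show "ennreal (r powr (- a) * exp ((1 - 1 / r) * ?s g)) * ?H (?m g, ?s g) =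
            ennreal (indicator {0<..} r * (?s g powr a * r powr (- a - 1) * exp (- ?s g / r) / Gamma a)) *
            h (?m g / ?s g, ?s g)"
            by (simp only: prod.case ennreal_mult3 eq)
        qed
        finally show ?thesis .
      next
        case False
        have "AE g in ?N. ennreal (?s g) * (ennreal (?d (?s g * r)) * h (?m g / ?s g, ?s g * r)) = 0"
          using s_pos by eventually_elim (use False in \<open>simp add: indicator_def zero_less_mult_iff\<close>)
        then have "(\<integral>\<^sup>+g. ennreal (?s g) * (ennreal (?d (?s g * r)) * h (?m g / ?s g, ?s g * r)) \<partial>?N) = (\<integral>\<^sup>+g. 0 \<partial>?N)"
          by (rule nn_integral_cong_AE)
        with False show ?thesis by simp
      qed
    qed
    also have "\<dots> = (\<integral>\<^sup>+g. \<integral>\<^sup>+r. ennreal (indicator {0<..} r * (?s g powr a * r powr (- a - 1) * exp (- ?s g / r) / Gamma a)) *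
        h (?m g / ?s g, ?s g) \<partial>lborel \<partial>?N)"
      by (rule P.Fubini') measurable
    also have "\<dots> = (\<integral>\<^sup>+g. K (?s g) * h (?m g / ?s g, ?s g) \<partial>?N)"
      unfolding K_def by (rule nn_integral_cong, rule nn_integral_multc) measurable
    also have "\<dots> = (\<integral>\<^sup>+g. K 1 * h (?m g / ?s g, ?s g) \<partial>?N)"
      by (rule nn_integral_cong_AE, use s_pos in eventually_elim) (subst K, assumption, rule refl)
    finally show ?thesis .
  qed
  interpret A: prob_space "gamma_law a" using a by (intro prob_space_gamma_law) simp
  have "K 1 = 1"
    using main[of "\<lambda>_. 1"] N.emeasure_space_1 A.emeasure_space_1 by simp
  with main[OF f] show ?thesis by (simp add: a_def)
qed

section \<open>Finite Dirichlet combinations\<close>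

text \<open>
  The total mass comes out of the beta-gamma algebra for the constant function 1: gamma laws have
  mass 1.
\<close>
lemma prob_space_beta_law:
  assumes a: "0 < a" and b: "0 \<le> b" shows "prob_space (beta_law a b)"
proof (intro prob_spaceI)
  interpret A: prob_space "gamma_law a" using a by (intro prob_space_gamma_law) simp
  interpret B: prob_space "gamma_law b" using b by (rule prob_space_gamma_law)
  interpret C: prob_space "gamma_law (a + b)" using a b by (intro prob_space_gamma_law) simp
  show "emeasure (beta_law a b) (space (beta_law a b)) = 1"
    using beta_gamma_algebra[OF a b, of "\<lambda>_. 1"] A.emeasure_space_1 B.emeasure_space_1 C.emeasure_space_1
    by simp
qed

lemma gamma_law_add:
  fixes f :: "real \<Rightarrow> ennreal"
  assumes a: "0 \<le> a" and b: "0 \<le> b" and [measurable]: "f \<in> borel_measurable borel"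
  shows "(\<integral>\<^sup>+x. \<integral>\<^sup>+y. f (x + y) \<partial>gamma_law b \<partial>gamma_law a) = (\<integral>\<^sup>+s. f s \<partial>gamma_law (a + b))"
proof (cases "a = 0")
  case True
  interpret B: prob_space "gamma_law b" using b by (rule prob_space_gamma_law)
  from True show ?thesis by (simp add: gamma_law_def[of 0] nn_integral_return)
next
  case False
  with a have a: "0 < a" by simp
  interpret prob_space "beta_law a b" using a b by (rule prob_space_beta_law)
  show ?thesis
    using beta_gamma_algebra[OF a b, of "\<lambda>p. f (fst p)"] emeasure_space_1 by simp
qed

text \<open>
  Adding an independent gamma variable \<open>y\<close> to the coordinate \<open>j\<close> raises its parameter. Since \<open>v j = 0\<close>,
  the linear form does not see the change, and \<open>y\<close> enters through the sum alone.
\<close>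
lemma PiM_gamma_law_add_component:
  fixes f :: "real \<times> real \<Rightarrow> ennreal" and \<alpha> v :: "'i \<Rightarrow> real"
  assumes I: "finite I" "j \<in> I" and \<alpha>: "\<And>i. 0 \<le> \<alpha> i" and b: "0 \<le> b" and v: "v j = 0"
    and [measurable]: "f \<in> borel_measurable (borel \<Otimes>\<^sub>M borel)"
  shows "(\<integral>\<^sup>+g. f (\<Sum>i\<in>I. v i * g i, \<Sum>i\<in>I. g i) \<partial>PiM I (\<lambda>i. gamma_law ((\<alpha>(j := \<alpha> j + b)) i)))
       = (\<integral>\<^sup>+g. \<integral>\<^sup>+y. f (\<Sum>i\<in>I. v i * g i, (\<Sum>i\<in>I. g i) + y) \<partial>gamma_law b \<partial>PiM I (\<lambda>i. gamma_law (\<alpha> i)))"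
proof -
  define J where "J = I - {j}"
  have J: "finite J" "j \<notin> J" and IJ: "I = insert j J" using I by (auto simp: J_def)
  let ?\<beta> = "\<alpha>(j := \<alpha> j + b)"
  have \<beta>: "0 \<le> ?\<beta> i" for i using \<alpha> b by simp
  interpret A: product_sigma_finite "\<lambda>i. gamma_law (\<alpha> i)"
    by (rule product_sigma_finite_gamma_law[OF \<alpha>])
  interpret B: product_sigma_finite "\<lambda>i. gamma_law (?\<beta> i)"
    by (rule product_sigma_finite_gamma_law[OF \<beta>])
  interpret G: prob_space "gamma_law b" by (rule prob_space_gamma_law[OF b])
  have upd: "(\<Sum>i\<in>insert j J. v i * (x(j := y)) i) = (\<Sum>i\<in>J. v i * x i)"
    "(\<Sum>i\<in>insert j J. (x(j := y)) i) = y + (\<Sum>i\<in>J. x i)" for x :: "'i \<Rightarrow> real" and y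
    using J v by (auto intro!: sum.cong arg_cong2[where f="(+)"])
  have "(\<integral>\<^sup>+g. f (\<Sum>i\<in>I. v i * g i, \<Sum>i\<in>I. g i) \<partial>PiM I (\<lambda>i. gamma_law (?\<beta> i)))
      = (\<integral>\<^sup>+x. \<integral>\<^sup>+u. f (\<Sum>i\<in>J. v i * x i, u + (\<Sum>i\<in>J. x i)) \<partial>gamma_law (\<alpha> j + b) \<partial>PiM J (\<lambda>i. gamma_law (?\<beta> i)))"
    unfolding IJ using J by (subst B.product_nn_integral_insert) (simp_all only: upd fun_upd_same, auto)
  also have "PiM J (\<lambda>i. gamma_law (?\<beta> i)) = PiM J (\<lambda>i. gamma_law (\<alpha> i))"
    using J by (intro PiM_cong) auto
  also have "(\<integral>\<^sup>+x. \<integral>\<^sup>+u. f (\<Sum>i\<in>J. v i * x i, u + (\<Sum>i\<in>J. x i)) \<partial>gamma_law (\<alpha> j + b) \<partial>PiM J (\<lambda>i. gamma_law (\<alpha> i)))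
      = (\<integral>\<^sup>+x. \<integral>\<^sup>+u. \<integral>\<^sup>+y. f (\<Sum>i\<in>J. v i * x i, u + y + (\<Sum>i\<in>J. x i)) \<partial>gamma_law b \<partial>gamma_law (\<alpha> j)
          \<partial>PiM J (\<lambda>i. gamma_law (\<alpha> i)))"
  proof (rule nn_integral_cong)
    fix x :: "'i \<Rightarrow> real"
    show "(\<integral>\<^sup>+u. f (\<Sum>i\<in>J. v i * x i, u + (\<Sum>i\<in>J. x i)) \<partial>gamma_law (\<alpha> j + b)) =
      (\<integral>\<^sup>+u. \<integral>\<^sup>+y. f (\<Sum>i\<in>J. v i * x i, u + y + (\<Sum>i\<in>J. x i)) \<partial>gamma_law b \<partial>gamma_law (\<alpha> j))"
      using \<alpha> b by (intro gamma_law_add[symmetric]) auto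
  qed
  also have "\<dots> = (\<integral>\<^sup>+x. \<integral>\<^sup>+u. \<integral>\<^sup>+y. f (\<Sum>i\<in>J. v i * x i, u + (\<Sum>i\<in>J. x i) + y) \<partial>gamma_law b \<partial>gamma_law (\<alpha> j)
          \<partial>PiM J (\<lambda>i. gamma_law (\<alpha> i)))"
    by (simp add: ac_simps)
  also have "\<dots> = (\<integral>\<^sup>+g. \<integral>\<^sup>+y. f (\<Sum>i\<in>I. v i * g i, (\<Sum>i\<in>I. g i) + y) \<partial>gamma_law b \<partial>PiM I (\<lambda>i. gamma_law (\<alpha> i)))"
    unfolding IJ using J by (subst A.product_nn_integral_insert) (simp_all only: upd, auto)
  finally show ?thesis .
qed

text \<open>
  The finite-dimensional core. Write \<open>m = \<Sum> v i * g i\<close> and \<open>S = \<Sum> g i\<close>. The beta variable is realised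
  as \<open>S / (S + y)\<close> with an independent gamma variable \<open>y\<close> of parameter \<open>b\<close>; this is legitimate
  because \<open>S\<close> is gamma distributed and independent of \<open>m / S\<close>. The product with \<open>m / S\<close> is then
  \<open>m / (S + y)\<close>, and \<open>y\<close> is absorbed into the coordinate whose weight vanishes.
\<close>
lemma beta_times_dirichlet_combination:
  fixes f :: "real \<Rightarrow> ennreal" and \<alpha> v :: "'i \<Rightarrow> real"
  assumes I: "finite I" "j \<in> I" and \<alpha>: "\<And>i. 0 \<le> \<alpha> i" and a: "0 < sum \<alpha> I" and b: "0 \<le> b" and v: "v j = 0"
    and [measurable]: "f \<in> borel_measurable borel"
  shows "(\<integral>\<^sup>+r. \<integral>\<^sup>+g. f (r * ((\<Sum>i\<in>I. v i * g i) / (\<Sum>i\<in>I. g i))) \<partial>PiM I (\<lambda>i. gamma_law (\<alpha> i)) \<partial>beta_law (sum \<alpha> I) b)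
       = (\<integral>\<^sup>+g. f ((\<Sum>i\<in>I. v i * g i) / (\<Sum>i\<in>I. g i)) \<partial>PiM I (\<lambda>i. gamma_law ((\<alpha>(j := \<alpha> j + b)) i)))"
proof -
  let ?N = "PiM I (\<lambda>i. gamma_law (\<alpha> i))" and ?a = "sum \<alpha> I"
  let ?m = "\<lambda>g :: 'i \<Rightarrow> real. \<Sum>i\<in>I. v i * g i" and ?s = "\<lambda>g :: 'i \<Rightarrow> real. \<Sum>i\<in>I. g i"
  interpret N: prob_space ?N
    by (intro prob_space_PiM prob_space_gamma_law \<alpha>)
  interpret A: prob_space "gamma_law ?a" using a by (intro prob_space_gamma_law) simp
  interpret B: prob_space "gamma_law b" using b by (rule prob_space_gamma_law)
  interpret C: prob_space "gamma_law (?a + b)" using a b by (intro prob_space_gamma_law) simp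
  interpret NB: pair_sigma_finite ?N "gamma_law b" ..
  interpret NA: pair_sigma_finite ?N "gamma_law ?a" ..
  \<comment> \<open>The dummy variable \<open>s\<close> is the sum that is independent of the beta variable \<open>r\<close>; it allows
    \<open>r\<close> to be replaced by a quotient of gamma variables.\<close>
  have "(\<integral>\<^sup>+r. \<integral>\<^sup>+g. f (r * (?m g / ?s g)) \<partial>?N \<partial>beta_law ?a b)
      = (\<integral>\<^sup>+s. \<integral>\<^sup>+r. \<integral>\<^sup>+g. f (r * (?m g / ?s g)) \<partial>?N \<partial>beta_law ?a b \<partial>gamma_law (?a + b))"
    using C.emeasure_space_1 by simp
  also have "\<dots> = (\<integral>\<^sup>+x. \<integral>\<^sup>+y. \<integral>\<^sup>+g. f (x / (x + y) * (?m g / ?s g)) \<partial>?N \<partial>gamma_law b \<partial>gamma_law ?a)"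
    using beta_gamma_algebra[OF a b, of "\<lambda>p. \<integral>\<^sup>+g. f (snd p * (?m g / ?s g)) \<partial>?N"] by simp
  also have "\<dots> = (\<integral>\<^sup>+x. \<integral>\<^sup>+g. \<integral>\<^sup>+y. f (x / (x + y) * (?m g / ?s g)) \<partial>gamma_law b \<partial>?N \<partial>gamma_law ?a)"
    by (rule nn_integral_cong, rule NB.Fubini') measurable
  also have "\<dots> = (\<integral>\<^sup>+g. \<integral>\<^sup>+x. \<integral>\<^sup>+y. f (x / (x + y) * (?m g / ?s g)) \<partial>gamma_law b \<partial>gamma_law ?a \<partial>?N)"
    by (rule NA.Fubini') measurable
  also have "\<dots> = (\<integral>\<^sup>+g. \<integral>\<^sup>+y. f (?s g / (?s g + y) * (?m g / ?s g)) \<partial>gamma_law b \<partial>?N)"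
    by (rule gamma_ratio_indep_sum[OF I(1) \<alpha> a, where f="\<lambda>(q, u). \<integral>\<^sup>+y. f (u / (u + y) * q) \<partial>gamma_law b",
          unfolded prod.case, symmetric]) measurable
  also have "\<dots> = (\<integral>\<^sup>+g. \<integral>\<^sup>+y. f (?m g / (?s g + y)) \<partial>gamma_law b \<partial>?N)"
    by (rule nn_integral_cong_AE, use AE_PiM_gamma_law_sum_pos[OF I(1) \<alpha> a] in eventually_elim) simp
  also have "\<dots> = (\<integral>\<^sup>+g. f (?m g / ?s g) \<partial>PiM I (\<lambda>i. gamma_law ((\<alpha>(j := \<alpha> j + b)) i)))"
    using PiM_gamma_law_add_component[of I j \<alpha> b v "\<lambda>p. f (fst p / snd p)"] I \<alpha> b v by simp
  finally show ?thesis .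
qed

section \<open>Equality of laws, and limits\<close>

lemma distr_eqI_nn_integral:
  assumes U [measurable]: "U \<in> M \<rightarrow>\<^sub>M S" and V [measurable]: "V \<in> N \<rightarrow>\<^sub>M S"
    and eq: "\<And>f :: _ \<Rightarrow> ennreal. f \<in> borel_measurable S \<Longrightarrow> (\<integral>\<^sup>+x. f (U x) \<partial>M) = (\<integral>\<^sup>+x. f (V x) \<partial>N)"
  shows "distr M S U = distr N S V"
proof (rule measure_eqI)
  fix A assume "A \<in> sets (distr M S U)"
  then have [measurable]: "A \<in> sets S" by simp
  have "emeasure (distr M S U) A = (\<integral>\<^sup>+x. indicator A (U x) \<partial>M)"
    by (simp add: nn_integral_distr flip: nn_integral_indicator)
  also have "\<dots> = (\<integral>\<^sup>+x. indicator A (V x) \<partial>N)"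
    by (rule eq) simp
  also have "\<dots> = emeasure (distr N S V) A"
    by (simp add: nn_integral_distr flip: nn_integral_indicator)
  finally show "emeasure (distr M S U) A = emeasure (distr N S V) A" .
qed simp

text \<open>
  The event that the supremum exceeds \<open>c\<close> is the increasing union of the events that the terms
  exceed \<open>c\<close>. Equality of laws thus passes to the limit although the two sequences live on different
  probability spaces, and infinite values are harmless.
\<close>
lemma distr_SUP_eq:
  fixes U :: "nat \<Rightarrow> 'a \<Rightarrow> ennreal" and V :: "nat \<Rightarrow> 'b \<Rightarrow> ennreal"
  assumes "prob_space M" "prob_space N"
    and U [measurable]: "\<And>n. U n \<in> borel_measurable M" and V [measurable]: "\<And>n. V n \<in> borel_measurable N"
    and mono: "\<And>x. x \<in> space M \<Longrightarrow> incseq (\<lambda>n. U n x)" "\<And>x. x \<in> space N \<Longrightarrow> incseq (\<lambda>n. V n x)"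
    and eq: "\<And>n. distr M borel (U n) = distr N borel (V n)"
  shows "distr M borel (\<lambda>x. SUP n. U n x) = distr N borel (\<lambda>x. SUP n. V n x)"
proof (rule measure_eqI_generator_eq[where E="range greaterThan \<union> {UNIV}" and \<Omega>=UNIV and A="\<lambda>_. UNIV"])
  interpret M: prob_space M by fact
  interpret N: prob_space N by fact
  have [simp]: "{a<..} \<inter> {b<..} = {max a b<..}" for a b :: ennreal by auto
  show "Int_stable (range (greaterThan :: ennreal \<Rightarrow> _) \<union> {UNIV})"
    by (auto simp: Int_stable_def)
  show "range (greaterThan :: ennreal \<Rightarrow> _) \<union> {UNIV} \<subseteq> Pow UNIV" by simp
  have "sigma_sets UNIV (range (greaterThan :: ennreal \<Rightarrow> _) \<union> {UNIV}) = sigma_sets UNIV (range greaterThan)"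
    by (intro sigma_sets_eqI) (auto intro: sigma_sets_top)
  then have borel: "sets (borel :: ennreal measure) = sigma_sets UNIV (range greaterThan \<union> {UNIV})"
    by (simp add: borel_Ioi)
  show "sets (distr M borel (\<lambda>x. SUP n. U n x)) = sigma_sets UNIV (range greaterThan \<union> {UNIV})"
    and "sets (distr N borel (\<lambda>x. SUP n. V n x)) = sigma_sets UNIV (range greaterThan \<union> {UNIV})"
    using borel by simp_all
  have tail: "emeasure (distr K borel (\<lambda>x. SUP n. Z n x)) {c<..} = (SUP n. emeasure (distr K borel (Z n)) {c<..})"
    if [measurable]: "\<And>n. Z n \<in> borel_measurable K" and inc: "\<And>x. x \<in> space K \<Longrightarrow> incseq (\<lambda>n. Z n x)"
    for K :: "'c measure" and Z :: "nat \<Rightarrow> 'c \<Rightarrow> ennreal" and c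
  proof -
    have "emeasure (distr K borel (\<lambda>x. SUP n. Z n x)) {c<..} = emeasure K (\<Union>n. {x \<in> space K. c < Z n x})"
      by (subst emeasure_distr) (auto simp: less_SUP_iff intro!: arg_cong[where f="emeasure K"])
    also have "\<dots> = (SUP n. emeasure K {x \<in> space K. c < Z n x})"
    proof (rule SUP_emeasure_incseq[symmetric])
      show "incseq (\<lambda>n. {x \<in> space K. c < Z n x})"
        using inc by (force simp: incseq_def intro: less_le_trans)
    qed auto
    also have "\<dots> = (SUP n. emeasure (distr K borel (Z n)) {c<..})"
      by (intro SUP_cong refl, subst emeasure_distr) (auto intro!: arg_cong[where f="emeasure K"])
    finally show ?thesis .
  qed
  show "emeasure (distr M borel (\<lambda>x. SUP n. U n x)) X = emeasure (distr N borel (\<lambda>x. SUP n. V n x)) X"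
    if "X \<in> range greaterThan \<union> {UNIV}" for X
    using that
  proof
    assume "X \<in> range greaterThan"
    then show ?thesis using tail[OF U mono(1)] tail[OF V mono(2)] by (auto simp only: eq)
  qed (simp add: emeasure_distr M.emeasure_space_1 N.emeasure_space_1)
  show "emeasure (distr M borel (\<lambda>x. SUP n. U n x)) UNIV \<noteq> \<infinity>"
    by (simp add: emeasure_distr M.emeasure_space_1)
qed auto

section \<open>The mean of a Dirichlet process\<close>

lemma space_nonneg_borel [simp]: "space nonneg_borel = {0..}"
  by (simp add: nonneg_borel_def space_restrict_space)

lemma sets_nonneg_borel_iff: "C \<in> sets nonneg_borel \<longleftrightarrow> C \<in> sets borel \<and> C \<subseteq> {0..}"
  by (auto simp: nonneg_borel_def sets_restrict_space_iff)

lemma measurable_ennreal_nonneg_borel [measurable]: "ennreal \<in> borel_measurable nonneg_borel"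
  unfolding nonneg_borel_def by (intro measurable_restrict_space1) measurable

text \<open>
  The level sets of a simple function form a finite partition of the half-line, to which the
  definition of a Dirichlet process applies. If the function vanishes at 0, then so does its value on
  the cell containing 0, which is the weight \<open>v j = 0\<close> of the finite-dimensional result.
\<close>
lemma simple_function_partition_at_0:
  fixes s :: "real \<Rightarrow> ennreal"
  assumes s: "simple_function nonneg_borel s" and fin: "\<And>x. s x < top" and s0: "s 0 = 0"
  obtains k C j and v :: "nat \<Rightarrow> real" where
    "\<And>i. i < k \<Longrightarrow> C i \<in> sets nonneg_borel" "disjoint_family_on C {..<k}" "(\<Union>i<k. C i) = {0..}"
    "j < k" "0 \<in> C j" "v j = 0" "\<And>i. 0 \<le> v i"
    "\<And>N. sets N = sets nonneg_borel \<Longrightarrow> prob_space N \<Longrightarrow>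
      (\<integral>\<^sup>+x. s x \<partial>N) = ennreal (\<Sum>i<k. v i * measure N (C i))"
proof -
  let ?R = "s ` {0..}"
  have R: "finite ?R" using simple_functionD(1)[OF s] by simp
  obtain e where e: "bij_betw e {..<card ?R} ?R"
    using ex_bij_betw_nat_finite[OF R] by (auto simp: atLeast0LessThan)
  \<comment> \<open>\<open>e\<close> enumerates the values of \<open>s\<close>, and the cells are the corresponding level sets\<close>
  define C where "C = (\<lambda>i. s -` {e i} \<inter> {0..})"
  define v where "v = (\<lambda>i. enn2real (e i))"
  have "0 \<in> ?R" using s0 by (metis atLeast_iff imageI order_refl)
  then obtain j where j: "j < card ?R" "e j = 0"
    using bij_betw_imp_surj_on[OF e] by (metis imageE lessThan_iff)
  show thesis
  proof (rule that[of "card ?R" C j v])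
    show "C i \<in> sets nonneg_borel" for i
      using simple_functionD(2)[OF s, of "{e i}"] by (simp add: C_def)
    show "disjoint_family_on C {..<card ?R}"
      using bij_betw_imp_inj_on[OF e] by (force simp: disjoint_family_on_def C_def inj_on_def)
    show "(\<Union>i<card ?R. C i) = {0..}"
      using bij_betw_imp_surj_on[OF e] by (force simp: C_def)
    show "j < card ?R" "0 \<in> C j" "v j = 0" "\<And>i. 0 \<le> v i"
      using j s0 by (simp_all add: C_def v_def)
  next
    fix N :: "real measure" assume N: "sets N = sets nonneg_borel" and "prob_space N"
    interpret N: prob_space N by fact
    have sp: "space N = {0..}" using sets_eq_imp_space_eq[OF N] by simp
    have sN: "simple_function N s"
      using s unfolding simple_function_def sets_eq_imp_space_eq[OF N] N .
    have "(\<integral>\<^sup>+x. s x \<partial>N) = (\<Sum>y\<in>?R. y * emeasure N (s -` {y} \<inter> {0..}))"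
      using nn_integral_eq_simple_integral[OF sN] by (simp add: simple_integral_def sp)
    also have "\<dots> = (\<Sum>i<card ?R. e i * emeasure N (C i))"
      unfolding C_def by (rule sum.reindex_bij_betw[OF e, symmetric])
    also have "\<dots> = (\<Sum>i<card ?R. ennreal (v i * measure N (C i)))"
    proof (rule sum.cong)
      fix i assume "i \<in> {..<card ?R}"
      then have "e i \<in> ?R" using e by (rule bij_betwE[THEN bspec, rotated])
      then have "e i < top" using fin by auto
      then show "e i * emeasure N (C i) = ennreal (v i * measure N (C i))"
        by (simp add: v_def N.emeasure_eq_measure ennreal_mult)
    qed simp
    also have "\<dots> = ennreal (\<Sum>i<card ?R. v i * measure N (C i))"
      by (simp add: v_def)
    finally show "(\<integral>\<^sup>+x. s x \<partial>N) = ennreal (\<Sum>i<card ?R. v i * measure N (C i))" .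
  qed
qed

lemma dirichlet_process_nn_integral:
  fixes f :: "real \<Rightarrow> ennreal" and k :: nat
  assumes P: "dirichlet_process W \<theta> F P"
    and C: "\<And>i. i < k \<Longrightarrow> C i \<in> sets nonneg_borel" "disjoint_family_on C {..<k}" "(\<Union>i<k. C i) = {0..}"
    and [measurable]: "f \<in> borel_measurable borel"
  shows "(\<integral>\<^sup>+w. f (\<Sum>i<k. v i * measure (P w) (C i)) \<partial>W)
       = (\<integral>\<^sup>+g. f ((\<Sum>i<k. v i * g i) / (\<Sum>i<k. g i)) \<partial>PiM {..<k} (\<lambda>i. gamma_law (\<theta> * measure F (C i))))"
proof -
  have [measurable]: "P \<in> W \<rightarrow>\<^sub>M subprob_algebra nonneg_borel"
    using P by (auto simp: dirichlet_process_def intro: measurable_prob_algebraD)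
  have [measurable]: "(\<lambda>w. measure (P w) (C i)) \<in> borel_measurable W" if "i < k" for i
    using C(1)[OF that] unfolding measure_def by measurable
  have law: "distr W (PiM {..<k} (\<lambda>_. borel)) (\<lambda>w. \<lambda>i\<in>{..<k}. measure (P w) (C i))
      = dirichlet_law k (\<lambda>i. \<theta> * measure F (C i))"
    using P C by (auto simp: dirichlet_process_def)
  have "(\<integral>\<^sup>+w. f (\<Sum>i<k. v i * measure (P w) (C i)) \<partial>W)
      = (\<integral>\<^sup>+h. f (\<Sum>i<k. v i * h i) \<partial>distr W (PiM {..<k} (\<lambda>_. borel)) (\<lambda>w. \<lambda>i\<in>{..<k}. measure (P w) (C i)))"
    by (subst nn_integral_distr) (auto intro!: measurable_restrict)
  also have "\<dots> = (\<integral>\<^sup>+g. f (\<Sum>i<k. v i * (g i / (\<Sum>i<k. g i))) \<partial>PiM {..<k} (\<lambda>i. gamma_law (\<theta> * measure F (C i))))"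
    unfolding law dirichlet_law_def by (subst nn_integral_distr) (auto intro!: measurable_restrict)
  finally show ?thesis by (simp add: sum_divide_distrib)
qed

lemma dirichlet_process_mean_SUP:
  assumes P: "dirichlet_process W \<theta> F P" and w: "w \<in> space W"
    and s: "\<And>n. simple_function nonneg_borel (s n)" "incseq s" "\<And>x. (SUP n. s n x) = ennreal x"
  shows "(\<integral>\<^sup>+x. ennreal x \<partial>P w) = (SUP n. \<integral>\<^sup>+x. s n x \<partial>P w)"
    and "incseq (\<lambda>n. \<integral>\<^sup>+x. s n x \<partial>P w)"
    and "sets (P w) = sets nonneg_borel" "prob_space (P w)"
proof -
  have "P w \<in> space (prob_algebra nonneg_borel)"
    using P w by (auto simp: dirichlet_process_def dest: measurable_space)
  then show Pw: "sets (P w) = sets nonneg_borel" "prob_space (P w)"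
    by (auto simp: space_prob_algebra)
  have "s n \<in> borel_measurable (P w)" for n
    using borel_measurable_simple_function[OF s(1)] by (simp cong: measurable_cong_sets add: Pw)
  then show "(\<integral>\<^sup>+x. ennreal x \<partial>P w) = (SUP n. \<integral>\<^sup>+x. s n x \<partial>P w)"
    using s(2) by (subst nn_integral_monotone_convergence_SUP[symmetric]) (auto simp: s(3))
  show "incseq (\<lambda>n. \<integral>\<^sup>+x. s n x \<partial>P w)"
    using s(2) by (auto simp: incseq_def le_fun_def intro!: nn_integral_mono)
qed

text \<open>
  The hypothesis on \<open>F'\<close> says that the parameter measure of \<open>P'\<close> is that of \<open>P\<close> with an additional mass
  \<open>b\<close> at 0. Approximate \<open>x\<close> from below by simple functions. They vanish at 0, so for each of them the
  additional mass falls into a cell of weight 0, and the claim is the finite-dimensional one. Monotone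
  convergence transports it to the mean.
\<close>
lemma dirichlet_process_mean_beta_scaling:
  assumes P: "dirichlet_process W a F P" and P': "dirichlet_process W' (a + b) F' P'"
    and a: "0 < a" and b: "0 \<le> b"
    and F: "prob_space F" "sets F = sets borel" "measure F {0..} = 1"
    and F': "\<And>C. C \<in> sets nonneg_borel \<Longrightarrow> (a + b) * measure F' C = a * measure F C + b * indicator C 0"
  shows "distr (beta_law a b \<Otimes>\<^sub>M W) borel (\<lambda>(r, w). ennreal r * (\<integral>\<^sup>+x. ennreal x \<partial>P w))
       = distr W' borel (\<lambda>w. \<integral>\<^sup>+x. ennreal x \<partial>P' w)"
proof -
  interpret F: prob_space F by fact
  interpret W: prob_space W using P by (simp add: dirichlet_process_def)
  interpret W': prob_space W' using P' by (simp add: dirichlet_process_def)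
  interpret B: prob_space "beta_law a b" using a b by (rule prob_space_beta_law)
  interpret BW: pair_prob_space "beta_law a b" W ..
  have [measurable]: "P \<in> W \<rightarrow>\<^sub>M subprob_algebra nonneg_borel" "P' \<in> W' \<rightarrow>\<^sub>M subprob_algebra nonneg_borel"
    using P P' by (auto simp: dirichlet_process_def intro: measurable_prob_algebraD)
  obtain s :: "nat \<Rightarrow> real \<Rightarrow> ennreal" where s: "\<And>n. simple_function nonneg_borel (s n)" "incseq s"
    "\<And>n x. s n x < top" "\<And>x. (SUP n. s n x) = ennreal x"
    using borel_measurable_implies_simple_function_sequence'[OF measurable_ennreal_nonneg_borel] by blast
  have [measurable]: "s n \<in> borel_measurable nonneg_borel" for n
    using s(1) by (rule borel_measurable_simple_function)
  have s0: "s n 0 = 0" for n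
    using SUP_upper[of n UNIV "\<lambda>n. s n 0"] s(4)[of 0] by simp
  note sup = dirichlet_process_mean_SUP[OF P _ s(1,2,4)]
  note sup' = dirichlet_process_mean_SUP[OF P' _ s(1,2,4)]
  have "distr (beta_law a b \<Otimes>\<^sub>M W) borel (\<lambda>(r, w). ennreal r * (\<integral>\<^sup>+x. s n x \<partial>P w))
      = distr W' borel (\<lambda>w. \<integral>\<^sup>+x. s n x \<partial>P' w)" for n
  proof (rule distr_eqI_nn_integral)
    fix f :: "ennreal \<Rightarrow> ennreal" assume [measurable]: "f \<in> borel_measurable borel"
    obtain k C j and v :: "nat \<Rightarrow> real" where C: "\<And>i. i < k \<Longrightarrow> C i \<in> sets nonneg_borel"
        "disjoint_family_on C {..<k}" "(\<Union>i<k. C i) = {0..}"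
      and j: "j < k" "0 \<in> C j" "v j = 0" and v: "\<And>i. 0 \<le> v i"
      and int: "\<And>N. sets N = sets nonneg_borel \<Longrightarrow> prob_space N \<Longrightarrow>
        (\<integral>\<^sup>+x. s n x \<partial>N) = ennreal (\<Sum>i<k. v i * measure N (C i))"
      using simple_function_partition_at_0[OF s(1,3) s0, of n] by blast
    define \<alpha> where "\<alpha> = (\<lambda>i. a * measure F (C i))"
    have \<alpha>: "0 \<le> \<alpha> i" for i using a by (simp add: \<alpha>_def)
    have "(\<Sum>i<k. measure F (C i)) = measure F (\<Union>i<k. C i)"
      using C by (intro F.finite_measure_finite_Union[symmetric]) (auto simp: F(2) sets_nonneg_borel_iff)
    then have sum_\<alpha>: "sum \<alpha> {..<k} = a"
      using C(3) F(3) by (simp add: \<alpha>_def flip: sum_distrib_left)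
    have \<alpha>': "(a + b) * measure F' (C i) = (\<alpha>(j := \<alpha> j + b)) i" if "i < k" for i
    proof (cases "i = j")
      case False
      then have "0 \<notin> C i" using C(2) j that by (auto simp: disjoint_family_on_def)
      with False show ?thesis using F'[OF C(1)[OF that]] by (simp add: \<alpha>_def)
    qed (use j F'[OF C(1)[OF that]] in \<open>simp add: \<alpha>_def\<close>)
    have "(\<integral>\<^sup>+x. f (case x of (r, w) \<Rightarrow> ennreal r * (\<integral>\<^sup>+x. s n x \<partial>P w)) \<partial>(beta_law a b \<Otimes>\<^sub>M W))
        = (\<integral>\<^sup>+r. \<integral>\<^sup>+w. f (ennreal r * (\<integral>\<^sup>+x. s n x \<partial>P w)) \<partial>W \<partial>beta_law a b)"
      by (subst W.nn_integral_fst[symmetric]) auto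
    also have "\<dots> = (\<integral>\<^sup>+r. \<integral>\<^sup>+w. f (ennreal (r * (\<Sum>i<k. v i * measure (P w) (C i)))) \<partial>W \<partial>beta_law a b)"
      using v by (auto intro!: nn_integral_cong simp: int sup ennreal_mult'' sum_nonneg)
    also have "\<dots> = (\<integral>\<^sup>+r. \<integral>\<^sup>+g. f (ennreal (r * ((\<Sum>i<k. v i * g i) / (\<Sum>i<k. g i))))
        \<partial>PiM {..<k} (\<lambda>i. gamma_law (\<alpha> i)) \<partial>beta_law a b)"
      unfolding \<alpha>_def
      by (rule nn_integral_cong, rule dirichlet_process_nn_integral[OF P C]) auto
    also have "\<dots> = (\<integral>\<^sup>+g. f (ennreal ((\<Sum>i<k. v i * g i) / (\<Sum>i<k. g i)))
        \<partial>PiM {..<k} (\<lambda>i. gamma_law ((\<alpha>(j := \<alpha> j + b)) i)))"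
      using beta_times_dirichlet_combination[of "{..<k}" j \<alpha> b v "\<lambda>x. f (ennreal x)"] j \<alpha> a b
      by (simp add: sum_\<alpha>)
    also have "PiM {..<k} (\<lambda>i. gamma_law ((\<alpha>(j := \<alpha> j + b)) i)) =
        PiM {..<k} (\<lambda>i. gamma_law ((a + b) * measure F' (C i)))"
      by (intro PiM_cong) (auto simp only: \<alpha>' lessThan_iff)
    also have "(\<integral>\<^sup>+g. f (ennreal ((\<Sum>i<k. v i * g i) / (\<Sum>i<k. g i)))
        \<partial>PiM {..<k} (\<lambda>i. gamma_law ((a + b) * measure F' (C i)))) =
        (\<integral>\<^sup>+w. f (ennreal (\<Sum>i<k. v i * measure (P' w) (C i))) \<partial>W')"
      by (rule dirichlet_process_nn_integral[OF P' C, symmetric]) auto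
    also have "\<dots> = (\<integral>\<^sup>+w. f (\<integral>\<^sup>+x. s n x \<partial>P' w) \<partial>W')"
      by (intro nn_integral_cong) (simp add: int sup')
    finally show "(\<integral>\<^sup>+x. f (case x of (r, w) \<Rightarrow> ennreal r * (\<integral>\<^sup>+x. s n x \<partial>P w)) \<partial>(beta_law a b \<Otimes>\<^sub>M W))
      = (\<integral>\<^sup>+w. f (\<integral>\<^sup>+x. s n x \<partial>P' w) \<partial>W')" .
  qed measurable
  then have "distr (beta_law a b \<Otimes>\<^sub>M W) borel (\<lambda>x. SUP n. case x of (r, w) \<Rightarrow> ennreal r * (\<integral>\<^sup>+x. s n x \<partial>P w))
      = distr W' borel (\<lambda>w. SUP n. \<integral>\<^sup>+x. s n x \<partial>P' w)"
    by (intro distr_SUP_eq BW.prob_space_axioms W'.prob_space_axioms)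
      (auto simp: space_pair_measure incseq_def intro!: mult_left_mono sup(2)[THEN incseqD] sup'(2)[THEN incseqD])
  also have "distr (beta_law a b \<Otimes>\<^sub>M W) borel (\<lambda>x. SUP n. case x of (r, w) \<Rightarrow> ennreal r * (\<integral>\<^sup>+x. s n x \<partial>P w))
      = distr (beta_law a b \<Otimes>\<^sub>M W) borel (\<lambda>(r, w). ennreal r * (\<integral>\<^sup>+x. ennreal x \<partial>P w))"
    by (intro distr_cong) (auto simp: space_pair_measure sup(1) SUP_mult_left_ennreal)
  also have "distr W' borel (\<lambda>w. SUP n. \<integral>\<^sup>+x. s n x \<partial>P' w) = distr W' borel (\<lambda>w. \<integral>\<^sup>+x. ennreal x \<partial>P' w)"
    by (intro distr_cong) (auto simp: sup'(1))
  finally show ?thesis .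
qed

lemma AE_beta_law_nonneg: "AE r in beta_law a b. 0 \<le> r"
  unfolding beta_law_def by (cases "b = 0") (simp_all add: AE_density AE_return indicator_def)

text \<open>
  Dirichlet means are defined by a law on the extended half-line; being finite, they return to the
  reals through \<open>enn2real\<close>.
\<close>
lemma dirichlet_mean_beta_scaling:
  assumes M: "dirichlet_mean \<Omega> a F M" and M': "dirichlet_mean \<Omega>' (a + b) F' M'"
    and \<Omega>: "prob_space \<Omega>" and a: "0 < a" and b: "0 \<le> b"
    and F: "prob_space F" "sets F = sets borel" "measure F {0..} = 1"
    and F': "\<And>C. C \<in> sets nonneg_borel \<Longrightarrow> (a + b) * measure F' C = a * measure F C + b * indicator C 0"
  shows "distr (beta_law a b \<Otimes>\<^sub>M distr \<Omega> borel M) borel (\<lambda>(r, m). r * m) = distr \<Omega>' borel M'"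
proof -
  interpret prob_space \<Omega> by fact
  obtain W :: "real measure measure" and P where P: "dirichlet_process W a F P"
    and law: "distr \<Omega> borel (\<lambda>\<omega>. ennreal (M \<omega>)) = distr W borel (\<lambda>w. \<integral>\<^sup>+x. ennreal x \<partial>P w)"
    using M by (auto simp: dirichlet_mean_def)
  obtain W' :: "real measure measure" and P' where P': "dirichlet_process W' (a + b) F' P'"
    and law': "distr \<Omega>' borel (\<lambda>\<omega>. ennreal (M' \<omega>)) = distr W' borel (\<lambda>w. \<integral>\<^sup>+x. ennreal x \<partial>P' w)"
    using M' by (auto simp: dirichlet_mean_def)
  have [measurable]: "M \<in> borel_measurable \<Omega>" "M' \<in> borel_measurable \<Omega>'"
    and nn: "AE \<omega> in \<Omega>. 0 \<le> M \<omega>" "AE \<omega> in \<Omega>'. 0 \<le> M' \<omega>"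
    using M M' by (auto simp: dirichlet_mean_def)
  interpret W: prob_space W using P by (simp add: dirichlet_process_def)
  interpret D: prob_space "distr \<Omega> borel M" by (rule prob_space_distr) measurable
  have [measurable]: "P \<in> W \<rightarrow>\<^sub>M subprob_algebra nonneg_borel" "P' \<in> W' \<rightarrow>\<^sub>M subprob_algebra nonneg_borel"
    using P P' by (auto simp: dirichlet_process_def intro: measurable_prob_algebraD)
  have scaling: "distr (beta_law a b \<Otimes>\<^sub>M W) borel (\<lambda>(r, w). ennreal r * (\<integral>\<^sup>+x. ennreal x \<partial>P w))
      = distr W' borel (\<lambda>w. \<integral>\<^sup>+x. ennreal x \<partial>P' w)"
    using F' by (rule dirichlet_process_mean_beta_scaling[OF P P' a b F])
  show ?thesis
  proof (rule distr_eqI_nn_integral)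
    fix f :: "real \<Rightarrow> ennreal" assume [measurable]: "f \<in> borel_measurable borel"
    have transport: "(\<integral>\<^sup>+\<omega>. h (ennreal (M \<omega>)) \<partial>\<Omega>) = (\<integral>\<^sup>+w. h (\<integral>\<^sup>+x. ennreal x \<partial>P w) \<partial>W)"
      if [measurable]: "h \<in> borel_measurable borel" for h :: "ennreal \<Rightarrow> ennreal"
      using arg_cong[OF law, of "\<lambda>N. \<integral>\<^sup>+y. h y \<partial>N"] by (simp add: nn_integral_distr)
    have "(\<integral>\<^sup>+p. f (case p of (r, m) \<Rightarrow> r * m) \<partial>(beta_law a b \<Otimes>\<^sub>M distr \<Omega> borel M))
        = (\<integral>\<^sup>+r. \<integral>\<^sup>+\<omega>. f (r * M \<omega>) \<partial>\<Omega> \<partial>beta_law a b)"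
      by (subst D.nn_integral_fst[symmetric]) (auto simp: nn_integral_distr)
    also have "\<dots> = (\<integral>\<^sup>+r. \<integral>\<^sup>+\<omega>. f (enn2real (ennreal r * ennreal (M \<omega>))) \<partial>\<Omega> \<partial>beta_law a b)"
    proof (rule nn_integral_cong_AE, use AE_beta_law_nonneg in eventually_elim)
      fix r :: real assume r: "0 \<le> r"
      show "(\<integral>\<^sup>+\<omega>. f (r * M \<omega>) \<partial>\<Omega>) = (\<integral>\<^sup>+\<omega>. f (enn2real (ennreal r * ennreal (M \<omega>))) \<partial>\<Omega>)"
        by (rule nn_integral_cong_AE, use nn(1) in eventually_elim) (simp add: r enn2real_mult)
    qed
    also have "\<dots> = (\<integral>\<^sup>+r. \<integral>\<^sup>+w. f (enn2real (ennreal r * (\<integral>\<^sup>+x. ennreal x \<partial>P w))) \<partial>W \<partial>beta_law a b)"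
      by (rule nn_integral_cong, rule transport) measurable
    also have "\<dots> = (\<integral>\<^sup>+y. f (enn2real y) \<partial>distr (beta_law a b \<Otimes>\<^sub>M W) borel (\<lambda>(r, w). ennreal r * (\<integral>\<^sup>+x. ennreal x \<partial>P w)))"
      by (subst nn_integral_distr) (auto simp: W.nn_integral_fst[symmetric])
    also have "\<dots> = (\<integral>\<^sup>+y. f (enn2real y) \<partial>distr \<Omega>' borel (\<lambda>\<omega>. ennreal (M' \<omega>)))"
      by (simp only: scaling law')
    also have "\<dots> = (\<integral>\<^sup>+\<omega>. f (enn2real (ennreal (M' \<omega>))) \<partial>\<Omega>')"
      by (rule nn_integral_distr) auto
    also have "\<dots> = (\<integral>\<^sup>+\<omega>. f (M' \<omega>) \<partial>\<Omega>')"
      by (rule nn_integral_cong_AE, use nn(2) in eventually_elim) simp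
    finally show "(\<integral>\<^sup>+p. f (case p of (r, m) \<Rightarrow> r * m) \<partial>(beta_law a b \<Otimes>\<^sub>M distr \<Omega> borel M)) = (\<integral>\<^sup>+\<omega>. f (M' \<omega>) \<partial>\<Omega>')" .
  qed measurable
qed

section \<open>Products of independent variables\<close>

lemma (in prob_space) distr_mult_indep:
  fixes A Z :: "'a \<Rightarrow> real"
  assumes "indep_var borel A borel Z"
  shows "distr M borel (\<lambda>\<omega>. A \<omega> * Z \<omega>) = distr (distr M borel A \<Otimes>\<^sub>M distr M borel Z) borel (\<lambda>(x, y). x * y)"
proof -
  have [measurable]: "A \<in> borel_measurable M" "Z \<in> borel_measurable M"
    and eq: "distr M borel A \<Otimes>\<^sub>M distr M borel Z = distr M (borel \<Otimes>\<^sub>M borel) (\<lambda>\<omega>. (A \<omega>, Z \<omega>))"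
    using assms by (auto simp: indep_var_distribution_eq)
  show ?thesis unfolding eq by (subst distr_distr) (auto simp: comp_def)
qed

lemma nn_integral_mult_pair:
  fixes f :: "real \<Rightarrow> ennreal"
  assumes "prob_space B" "sets A = sets borel" "sets B = sets borel" "f \<in> borel_measurable borel"
  shows "(\<integral>\<^sup>+z. f z \<partial>distr (A \<Otimes>\<^sub>M B) borel (\<lambda>(x, y). x * y)) = (\<integral>\<^sup>+x. \<integral>\<^sup>+y. f (x * y) \<partial>B \<partial>A)"
proof -
  interpret B: prob_space B by fact
  note [measurable_cong] = assms(2,3) and [measurable] = assms(4)
  show ?thesis by (subst nn_integral_distr) (auto simp: B.nn_integral_fst[symmetric])
qed

lemma real_measure_eqI_nn_integral:
  fixes M N :: "real measure"
  assumes "sets M = sets borel" "sets N = sets borel"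
    and "\<And>f :: real \<Rightarrow> ennreal. f \<in> borel_measurable borel \<Longrightarrow> (\<integral>\<^sup>+x. f x \<partial>M) = (\<integral>\<^sup>+x. f x \<partial>N)"
  shows "M = N"
proof -
  have "distr M borel (\<lambda>x. x) = distr N borel (\<lambda>x. x)"
    using assms by (intro distr_eqI_nn_integral) (auto cong: measurable_cong_sets)
  then show ?thesis using assms by (simp add: distr_id2)
qed

lemma distr_mult_one:
  assumes N: "prob_space N" "sets N = sets borel"
  shows "distr (return borel 1 \<Otimes>\<^sub>M N) borel (\<lambda>(x, y). x * y) = (N :: real measure)"
    and "distr (N \<Otimes>\<^sub>M return borel 1) borel (\<lambda>(x, y). x * y) = N"
proof -
  interpret N: prob_space N by fact
  have one: "prob_space (return borel (1 :: real))" by (rule prob_space_return) simp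
  note [measurable_cong] = N(2)
  show "distr (return borel 1 \<Otimes>\<^sub>M N) borel (\<lambda>(x, y). x * y) = N"
    by (rule real_measure_eqI_nn_integral) (auto simp: nn_integral_mult_pair N nn_integral_return)
  show "distr (N \<Otimes>\<^sub>M return borel 1) borel (\<lambda>(x, y). x * y) = N"
    by (rule real_measure_eqI_nn_integral) (auto simp: nn_integral_mult_pair one N nn_integral_return)
qed

text \<open>
  This is the identity \<open>(x + y) * (x / (x + y)) = x\<close> for independent gamma variables.
\<close>
lemma gamma_times_beta:
  fixes f :: "real \<Rightarrow> ennreal"
  assumes a: "0 < a" and b: "0 \<le> b" and [measurable]: "f \<in> borel_measurable borel"
  shows "(\<integral>\<^sup>+s. \<integral>\<^sup>+r. f (s * r) \<partial>beta_law a b \<partial>gamma_law (a + b)) = (\<integral>\<^sup>+x. f x \<partial>gamma_law a)"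
proof -
  interpret B: prob_space "gamma_law b" using b by (rule prob_space_gamma_law)
  have "(\<integral>\<^sup>+s. \<integral>\<^sup>+r. f (s * r) \<partial>beta_law a b \<partial>gamma_law (a + b))
      = (\<integral>\<^sup>+x. \<integral>\<^sup>+y. f ((x + y) * (x / (x + y))) \<partial>gamma_law b \<partial>gamma_law a)"
    using beta_gamma_algebra[OF a b, of "\<lambda>(s, r). f (s * r)"] by simp
  also have "\<dots> = (\<integral>\<^sup>+x. \<integral>\<^sup>+y. f x \<partial>gamma_law b \<partial>gamma_law a)"
  proof (rule nn_integral_cong_AE, use AE_gamma_law_pos[OF less_imp_neq[OF a, symmetric]] in eventually_elim)
    fix x :: real assume x: "0 < x"
    show "(\<integral>\<^sup>+y. f ((x + y) * (x / (x + y))) \<partial>gamma_law b) = (\<integral>\<^sup>+y. f x \<partial>gamma_law b)"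
      by (rule nn_integral_cong_AE, use AE_gamma_law_nonneg in eventually_elim) (use x in simp)
  qed
  also have "\<dots> = (\<integral>\<^sup>+x. f x \<partial>gamma_law a)"
    using B.emeasure_space_1 by simp
  finally show ?thesis .
qed

section \<open>Uniqueness of the mean, and generalised gamma convolutions\<close>

lemma dirichlet_mean_transfer:
  assumes M: "dirichlet_mean \<Omega> \<theta> F M" and [measurable]: "M' \<in> borel_measurable \<Omega>'"
    and eq: "distr \<Omega>' borel M' = distr \<Omega> borel M"
  shows "dirichlet_mean \<Omega>' \<theta> F M'"
proof -
  have [measurable]: "M \<in> borel_measurable \<Omega>" using M by (simp add: dirichlet_mean_def)
  have "AE x in distr \<Omega>' borel M'. 0 \<le> x"
    unfolding eq using M by (simp add: dirichlet_mean_def AE_distr_iff)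
  then have "AE \<omega> in \<Omega>'. 0 \<le> M' \<omega>" by (simp add: AE_distr_iff)
  moreover have "distr \<Omega>' borel (\<lambda>\<omega>. ennreal (M' \<omega>)) = distr \<Omega> borel (\<lambda>\<omega>. ennreal (M \<omega>))"
    using arg_cong[OF eq, of "\<lambda>N. distr N borel ennreal"] by (simp add: distr_distr comp_def)
  ultimately show ?thesis using M by (simp add: dirichlet_mean_def)
qed

text \<open>
  The case \<open>b = 0\<close> of the scaling result: a beta variable with second parameter 0 is 1, and the
  parameter measure does not change.
\<close>
lemma dirichlet_mean_unique:
  assumes M: "dirichlet_mean \<Omega> \<theta> F M" and M': "dirichlet_mean \<Omega>' \<theta> F M'"
    and \<Omega>: "prob_space \<Omega>" and \<theta>: "0 < \<theta>"
    and F: "prob_space F" "sets F = sets borel" "measure F {0..} = 1"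
  shows "distr \<Omega> borel M = distr \<Omega>' borel M'"
proof -
  interpret prob_space \<Omega> by fact
  have [measurable]: "M \<in> borel_measurable \<Omega>" using M by (simp add: dirichlet_mean_def)
  interpret D: prob_space "distr \<Omega> borel M" by (rule prob_space_distr) measurable
  have "distr (beta_law \<theta> 0 \<Otimes>\<^sub>M distr \<Omega> borel M) borel (\<lambda>(r, m). r * m) = distr \<Omega>' borel M'"
    using M' by (intro dirichlet_mean_beta_scaling[OF M _ \<Omega> \<theta> _ F]) auto
  then show ?thesis
    by (simp add: beta_law_def distr_mult_one D.prob_space_axioms)
qed

text \<open>
  The description defining \<open>GGC\<close> is satisfied by the joint law of \<open>(G, M)\<close> with the two coordinate
  projections, and uniqueness of the law of the mean leaves no other choice.
\<close>
lemma GGC_eq: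
  assumes \<Omega>: "prob_space \<Omega>" and G: "G \<in> borel_measurable \<Omega>" "distr \<Omega> borel G = gamma_law \<theta>"
    and M: "dirichlet_mean \<Omega> \<theta> F M" and indep: "prob_space.indep_var \<Omega> borel G borel M"
    and \<theta>: "0 < \<theta>" and F: "prob_space F" "sets F = sets borel" "measure F {0..} = 1"
  shows "GGC \<theta> F = distr \<Omega> borel (\<lambda>\<omega>. G \<omega> * M \<omega>)"
  unfolding GGC_def
proof (rule the_equality)
  interpret prob_space \<Omega> by fact
  note [measurable] = G(1)
  have [measurable]: "M \<in> borel_measurable \<Omega>" using M by (simp add: dirichlet_mean_def)
  let ?\<Omega> = "distr \<Omega> (borel \<Otimes>\<^sub>M borel) (\<lambda>\<omega>. (G \<omega>, M \<omega>))"
  have marginals: "distr ?\<Omega> borel fst = distr \<Omega> borel G" "distr ?\<Omega> borel snd = distr \<Omega> borel M"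
    by (auto simp: distr_distr comp_def)
  interpret pair: prob_space ?\<Omega> by (rule prob_space_distr) measurable
  have "pair.indep_var borel fst borel snd"
    using indep unfolding indep_var_distribution_eq pair.indep_var_distribution_eq marginals
    by (auto simp: distr_distr comp_def)
  moreover have "dirichlet_mean ?\<Omega> \<theta> F snd"
    by (rule dirichlet_mean_transfer[OF M]) (auto simp: marginals)
  moreover have "distr ?\<Omega> borel (\<lambda>\<omega>. fst \<omega> * snd \<omega>) = distr \<Omega> borel (\<lambda>\<omega>. G \<omega> * M \<omega>)"
    by (auto simp: distr_distr comp_def)
  ultimately show "\<exists>(\<Omega>' :: (real \<times> real) measure) G' M'.
        prob_space \<Omega>' \<and> G' \<in> borel_measurable \<Omega>' \<and> distr \<Omega>' borel G' = gamma_law \<theta> \<and>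
        dirichlet_mean \<Omega>' \<theta> F M' \<and> prob_space.indep_var \<Omega>' borel G' borel M' \<and>
        distr \<Omega> borel (\<lambda>\<omega>. G \<omega> * M \<omega>) = distr \<Omega>' borel (\<lambda>\<omega>. G' \<omega> * M' \<omega>)"
    using pair.prob_space_axioms marginals(1) G(2)
    by (intro exI[of _ ?\<Omega>] exI[of _ fst] exI[of _ snd]) auto
next
  fix L assume "\<exists>(\<Omega>' :: (real \<times> real) measure) G' M'.
        prob_space \<Omega>' \<and> G' \<in> borel_measurable \<Omega>' \<and> distr \<Omega>' borel G' = gamma_law \<theta> \<and>
        dirichlet_mean \<Omega>' \<theta> F M' \<and> prob_space.indep_var \<Omega>' borel G' borel M' \<and>
        L = distr \<Omega>' borel (\<lambda>\<omega>. G' \<omega> * M' \<omega>)"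
  then obtain \<Omega>' :: "(real \<times> real) measure" and G' M' where
    \<Omega>': "prob_space \<Omega>'" "distr \<Omega>' borel G' = gamma_law \<theta>" "dirichlet_mean \<Omega>' \<theta> F M'"
      "prob_space.indep_var \<Omega>' borel G' borel M'" and L: "L = distr \<Omega>' borel (\<lambda>\<omega>. G' \<omega> * M' \<omega>)"
    by blast
  show "L = distr \<Omega> borel (\<lambda>\<omega>. G \<omega> * M \<omega>)"
    unfolding L prob_space.distr_mult_indep[OF \<Omega>'(1,4)] prob_space.distr_mult_indep[OF \<Omega> indep]
    using dirichlet_mean_unique[OF \<Omega>'(3) M \<Omega>'(1) \<theta> F] by (simp add: \<Omega>'(2) G(2))
qed

lemma sets_bernoulli_law [simp, measurable_cong]: "sets (bernoulli_law p) = sets borel"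
  by (simp add: bernoulli_law_def)

section \<open>Bernoulli thinning\<close>

lemma measure_bernoulli_law:
  assumes p: "0 \<le> p" "p \<le> 1" and C: "C \<in> sets borel"
  shows "measure (bernoulli_law p) C = p * indicator C 1 + (1 - p) * indicator C 0"
proof -
  note [measurable] = C
  have "emeasure (bernoulli_law p) C = (\<integral>\<^sup>+y. indicator C (of_bool y) \<partial>measure_pmf (bernoulli_pmf p))"
    unfolding bernoulli_law_def by (simp add: nn_integral_distr flip: nn_integral_indicator)
  also have "\<dots> = ennreal (p * indicator C 1 + (1 - p) * indicator C 0)"
    using p by (simp add: indicator_def flip: ennreal_plus)
  finally show ?thesis using p by (simp add: measure_def del: ennreal_plus)
qed

lemma measure_mult_bernoulli:
  fixes X Y :: "'a \<Rightarrow> real"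
  assumes \<Omega>: "prob_space \<Omega>" and indep: "prob_space.indep_var \<Omega> borel X borel Y"
    and Y: "distr \<Omega> borel Y = bernoulli_law p" and p: "0 \<le> p" "p \<le> 1" and C: "C \<in> sets borel"
  shows "measure (distr \<Omega> borel (\<lambda>\<omega>. X \<omega> * Y \<omega>)) C = p * measure (distr \<Omega> borel X) C + (1 - p) * indicator C 0"
proof -
  interpret prob_space \<Omega> by fact
  have [measurable]: "X \<in> borel_measurable \<Omega>" "Y \<in> borel_measurable \<Omega>"
    using indep by (auto simp: indep_var_distribution_eq)
  note [measurable] = C
  interpret X: prob_space "distr \<Omega> borel X" by (rule prob_space_distr) measurable
  interpret Y: prob_space "bernoulli_law p" unfolding Y[symmetric] by (rule prob_space_distr) measurable
  have "emeasure (distr \<Omega> borel (\<lambda>\<omega>. X \<omega> * Y \<omega>)) C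
      = (\<integral>\<^sup>+x. \<integral>\<^sup>+y. indicator C (x * y) \<partial>bernoulli_law p \<partial>distr \<Omega> borel X)"
    unfolding distr_mult_indep[OF indep] Y
    by (subst nn_integral_mult_pair[symmetric])
      (auto simp: Y.prob_space_axioms)
  also have "\<dots> = (\<integral>\<^sup>+x. ennreal p * indicator C x + ennreal ((1 - p) * indicator C 0) \<partial>distr \<Omega> borel X)"
    using p by (intro nn_integral_cong)
      (auto simp: bernoulli_law_def nn_integral_distr indicator_def simp flip: ennreal_plus)
  also have "\<dots> = ennreal p * emeasure (distr \<Omega> borel X) C + ennreal ((1 - p) * indicator C 0)"
    using X.emeasure_space_1 by (subst nn_integral_add) (auto simp: nn_integral_cmult_indicator)
  also have "\<dots> = ennreal (p * measure (distr \<Omega> borel X) C + (1 - p) * indicator C 0)"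
    using p by (simp add: X.emeasure_eq_measure ennreal_mult')
  finally show ?thesis using p by (simp add: measure_def del: ennreal_plus)
qed

section \<open>The main result\<close>

text \<open>
  A constant point mass is a Dirichlet process with itself as parameter: in any partition a single
  cell has a gamma variable different from 0, and normalising turns it into 1. Inserting this mean
  into the scaling result identifies the mean for a Bernoulli parameter.
\<close>
lemma dirichlet_mean_point_mass:
  assumes \<Omega>: "prob_space \<Omega>" and \<theta>: "0 < \<theta>"
  shows "dirichlet_mean \<Omega> \<theta> (return borel 1) (\<lambda>_. 1)"
proof -
  interpret prob_space \<Omega> by fact
  \<comment> \<open>\<open>W\<close> is an arbitrary probability space of the required type, since \<open>P\<close> is constant\<close>
  define W :: "real measure measure" where "W = return (count_space UNIV) (return borel 0)"
  define P :: "real measure \<Rightarrow> real measure" where "P = (\<lambda>_. return nonneg_borel 1)"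
  interpret W: prob_space W unfolding W_def by (rule prob_space_return) simp
  have one: "prob_space (return nonneg_borel (1 :: real))" by (rule prob_space_return) simp
  have "distr W (PiM {..<k} (\<lambda>_. borel)) (\<lambda>w. \<lambda>i\<in>{..<k}. measure (P w) (C i))
      = dirichlet_law k (\<lambda>i. \<theta> * measure (return borel 1) (C i))"
    if C: "\<forall>i<k. C i \<in> sets nonneg_borel" "disjoint_family_on C {..<k}" "(\<Union>i<k. C i) = {0..}" for k and C :: "nat \<Rightarrow> real set"
  proof -
    let ?N = "PiM {..<k} (\<lambda>i. gamma_law (\<theta> * measure (return borel 1) (C i)))"
    have nn: "0 \<le> \<theta> * measure (return borel 1) (C i)" for i using \<theta> by simp
    interpret N: prob_space ?N by (intro prob_space_PiM prob_space_gamma_law nn)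
    have "1 \<in> (\<Union>i<k. C i)" using C(3) by simp
    then obtain j where j: "j < k" "1 \<in> C j" by auto
    have ind: "indicator (C i) (1 :: real) = (of_bool (i = j) :: real)" if "i < k" for i
      using C(2) j that by (auto simp: disjoint_family_on_def indicator_def)
    have R: "measure (return borel 1) (C i) = of_bool (i = j)" "measure (return nonneg_borel 1) (C i) = of_bool (i = j)" if "i < k" for i
      using C(1) that ind[OF that] by (auto simp: measure_return sets_nonneg_borel_iff)
    have "AE g in ?N. \<forall>i\<in>{..<k}. if i = j then 0 < g i else g i = 0"
    proof (intro AE_finite_allI)
      fix i assume i: "i \<in> {..<k}"
      show "AE g in ?N. if i = j then 0 < g i else g i = 0"
      proof (cases "i = j")
        case True
        then have "AE x in gamma_law (\<theta> * measure (return borel 1) (C i)). 0 < x"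
          using i \<theta> R by (intro AE_gamma_law_pos) auto
        with i True nn show ?thesis
          by (simp, intro AE_PiM_component prob_space_gamma_law) auto
      next
        case False
        then have zero: "\<theta> * measure (return borel 1) (C i) = 0"
          using i R(1)[of i] by simp
        have "AE x in gamma_law (\<theta> * measure (return borel 1) (C i)). x = 0"
          unfolding zero gamma_law_def by (simp add: AE_return)
        with i False nn show ?thesis
          by (simp, intro AE_PiM_component prob_space_gamma_law) auto
      qed
    qed simp
    then have AE: "AE g in ?N. (\<lambda>i\<in>{..<k}. g i / (\<Sum>j<k. g j)) = (\<lambda>i\<in>{..<k}. of_bool (i = j))"
    proof eventually_elim
      fix g assume g: "\<forall>i\<in>{..<k}. if i = j then 0 < g i else g i = (0 :: real)"
      then have "(\<Sum>i<k. g i) = (\<Sum>i<k. if i = j then g j else 0)"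
        by (intro sum.cong) (auto split: if_splits)
      then have "(\<Sum>i<k. g i) = g j" using j by simp
      with g j show "(\<lambda>i\<in>{..<k}. g i / (\<Sum>j<k. g j)) = (\<lambda>i\<in>{..<k}. of_bool (i = j))"
        by (auto simp: fun_eq_iff split: if_splits)
    qed
    have "(\<lambda>w. \<lambda>i\<in>{..<k}. measure (P w) (C i)) = (\<lambda>w. \<lambda>i\<in>{..<k}. of_bool (i = j))"
      by (auto simp: fun_eq_iff P_def R(2))
    moreover have "dirichlet_law k (\<lambda>i. \<theta> * measure (return borel 1) (C i)) =
        distr ?N (PiM {..<k} (\<lambda>_. borel)) (\<lambda>_. \<lambda>i\<in>{..<k}. of_bool (i = j))"
      unfolding dirichlet_law_def by (rule distr_cong_AE) (use AE in auto)
    moreover have "(\<lambda>i\<in>{..<k}. of_bool (i = j)) \<in> space (PiM {..<k} (\<lambda>_. borel :: real measure))"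
      by (simp add: space_PiM)
    ultimately show ?thesis
      by (simp only: W.distr_const N.distr_const)
  qed
  moreover have "P \<in> W \<rightarrow>\<^sub>M prob_algebra nonneg_borel"
    unfolding P_def by (intro measurable_const) (simp add: space_prob_algebra one)
  ultimately have "dirichlet_process W \<theta> (return borel 1) P"
    using W.prob_space_axioms by (simp add: dirichlet_process_def)
  moreover have "distr \<Omega> borel (\<lambda>_. ennreal 1) = distr W borel (\<lambda>w. \<integral>\<^sup>+x. ennreal x \<partial>P w)"
    by (simp add: P_def nn_integral_return W.distr_const distr_const)
  ultimately show ?thesis unfolding dirichlet_mean_def by auto
qed

theorem theorem2p1:
  fixes \<Omega> :: "'a measure"
    and \<theta> \<sigma> :: real
    and X Y B M_X M_Y M_XY G_\<theta>\<sigma> G_\<theta> :: "'a \<Rightarrow> real"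
  assumes "prob_space \<Omega>"
    and "0 < \<theta>" and "0 < \<sigma>" and "\<sigma> \<le> 1"
    and "X \<in> borel_measurable \<Omega>" and "AE \<omega> in \<Omega>. 0 \<le> X \<omega>"
    and "\<forall>l>0. integrable \<Omega> (\<lambda>\<omega>. ln (1 + l * X \<omega>))"
    and "Y \<in> borel_measurable \<Omega>" and "distr \<Omega> borel Y = bernoulli_law \<sigma>"
    and "prob_space.indep_var \<Omega> borel X borel Y"
    and "dirichlet_mean \<Omega> (\<theta> * \<sigma>) (distr \<Omega> borel X) M_X"
    and "dirichlet_mean \<Omega> \<theta> (distr \<Omega> borel Y) M_Y"
    and "dirichlet_mean \<Omega> \<theta> (distr \<Omega> borel (\<lambda>\<omega>. X \<omega> * Y \<omega>)) M_XY"
    and "B \<in> borel_measurable \<Omega>"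
    and "distr \<Omega> borel B = beta_law (\<theta> * \<sigma>) (\<theta> * (1 - \<sigma>))"
    and "prob_space.indep_var \<Omega> borel B borel M_X"
    and "prob_space.indep_var \<Omega> borel M_Y borel M_X"
    and "G_\<theta>\<sigma> \<in> borel_measurable \<Omega>" and "distr \<Omega> borel G_\<theta>\<sigma> = gamma_law (\<theta> * \<sigma>)"
    and "prob_space.indep_var \<Omega> borel G_\<theta>\<sigma> borel M_X"
    and "G_\<theta> \<in> borel_measurable \<Omega>" and "distr \<Omega> borel G_\<theta> = gamma_law \<theta>"
    and "prob_space.indep_var \<Omega> borel G_\<theta> borel M_XY"
  shows "distr \<Omega> borel (\<lambda>\<omega>. B \<omega> * M_X \<omega>) = distr \<Omega> borel M_XY \<and>
         distr \<Omega> borel (\<lambda>\<omega>. M_Y \<omega> * M_X \<omega>) = distr \<Omega> borel M_XY \<and>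
         distr \<Omega> borel (\<lambda>\<omega>. G_\<theta>\<sigma> \<omega> * M_X \<omega>) = distr \<Omega> borel (\<lambda>\<omega>. G_\<theta> \<omega> * M_XY \<omega>) \<and>
         GGC (\<theta> * \<sigma>) (distr \<Omega> borel X) = GGC \<theta> (distr \<Omega> borel (\<lambda>\<omega>. X \<omega> * Y \<omega>))"
proof -
  interpret prob_space \<Omega> by fact
  define a b where "a = \<theta> * \<sigma>" and "b = \<theta> * (1 - \<sigma>)"
  have a: "0 < a" and b: "0 \<le> b" and ab: "a + b = \<theta>" using assms(2-4) by (simp_all add: a_def b_def algebra_simps)
  note [measurable] = assms(5,8)
  have [measurable]: "M_X \<in> borel_measurable \<Omega>" using assms(11) by (simp add: dirichlet_mean_def)
  let ?F = "distr \<Omega> borel X" and ?F' = "distr \<Omega> borel (\<lambda>\<omega>. X \<omega> * Y \<omega>)"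
  have F: "prob_space ?F" "sets ?F = sets borel" "measure ?F {0..} = 1"
    and F': "prob_space ?F'" "sets ?F' = sets borel"
    using assms(6) by (auto intro!: prob_space_distr simp: measure_distr prob_eq_1)
  \<comment> \<open>the law of \<open>X * Y\<close>, scaled by \<open>\<theta>\<close>, is that of \<open>X\<close> scaled by \<open>a\<close>, with additional mass \<open>b\<close> at 0\<close>
  have mixture: "(a + b) * measure ?F' C = a * measure ?F C + b * indicator C 0" if "C \<in> sets borel" for C
    using assms(2-4) unfolding ab
    by (subst measure_mult_bernoulli[OF assms(1,10,9) _ _ that]) (simp_all add: a_def b_def algebra_simps)
  have "measure ?F' {0..} = 1"
    using mixture[of "{0..}"] F(3) a b by simp
  note F' = F' this
  note M_X = assms(11)[folded a_def] and M_XY = assms(13)[folded ab]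
  have i: "distr (beta_law a b \<Otimes>\<^sub>M distr \<Omega> borel M_X) borel (\<lambda>(r, m). r * m) = distr \<Omega> borel M_XY"
    using mixture by (intro dirichlet_mean_beta_scaling[OF M_X M_XY assms(1) a b F]) (auto simp: sets_nonneg_borel_iff)
  \<comment> \<open>the same result for the constant variable 1 in place of \<open>X\<close>, whose thinning is \<open>Y\<close> itself\<close>
  have "distr (beta_law a b \<Otimes>\<^sub>M distr \<Omega> borel (\<lambda>_. 1)) borel (\<lambda>(r, m). r * m) = distr \<Omega> borel M_Y"
  proof (rule dirichlet_mean_beta_scaling[OF dirichlet_mean_point_mass[OF assms(1) a] _ assms(1) a b, where F'="distr \<Omega> borel Y"])
    show "dirichlet_mean \<Omega> (a + b) (distr \<Omega> borel Y) M_Y" unfolding ab by fact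
    show "(a + b) * measure (distr \<Omega> borel Y) C = a * measure (return borel 1) C + b * indicator C 0"
      if "C \<in> sets nonneg_borel" for C
      using that assms(2-4) unfolding assms(9) a_def b_def
      by (simp add: sets_nonneg_borel_iff measure_bernoulli_law measure_return algebra_simps)
  qed (auto simp: prob_space_return measure_return)
  then have M_Y: "distr \<Omega> borel M_Y = beta_law a b"
    using distr_mult_one(2)[OF prob_space_beta_law[OF a b] sets_beta_law] by (simp add: distr_const)
  have iii: "distr \<Omega> borel (\<lambda>\<omega>. G_\<theta>\<sigma> \<omega> * M_X \<omega>) = distr \<Omega> borel (\<lambda>\<omega>. G_\<theta> \<omega> * M_XY \<omega>)"
  proof -
    have p: "prob_space (distr \<Omega> borel M_X)" "prob_space (distr \<Omega> borel M_XY)"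
      using M_XY by (auto intro!: prob_space_distr simp: dirichlet_mean_def)
    interpret D: prob_space "distr \<Omega> borel M_X" by fact
    have "distr (gamma_law a \<Otimes>\<^sub>M distr \<Omega> borel M_X) borel (\<lambda>(x, y). x * y)
        = distr (gamma_law \<theta> \<Otimes>\<^sub>M distr \<Omega> borel M_XY) borel (\<lambda>(x, y). x * y)" (is "?L = ?R")
    proof (rule real_measure_eqI_nn_integral)
      fix f :: "real \<Rightarrow> ennreal" assume f [measurable]: "f \<in> borel_measurable borel"
      have "(\<integral>\<^sup>+z. f z \<partial>?R) = (\<integral>\<^sup>+s. \<integral>\<^sup>+z. f (s * z) \<partial>distr \<Omega> borel M_XY \<partial>gamma_law (a + b))"
        unfolding ab by (rule nn_integral_mult_pair[OF p(2)]) auto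
      also have "\<dots> = (\<integral>\<^sup>+s. \<integral>\<^sup>+r. \<integral>\<^sup>+m. f (s * (r * m)) \<partial>distr \<Omega> borel M_X \<partial>beta_law a b \<partial>gamma_law (a + b))"
        unfolding i[symmetric] by (rule nn_integral_cong, rule nn_integral_mult_pair[OF p(1)]) auto
      also have "\<dots> = (\<integral>\<^sup>+s. \<integral>\<^sup>+r. (\<integral>\<^sup>+m. f (s * r * m) \<partial>distr \<Omega> borel M_X) \<partial>beta_law a b \<partial>gamma_law (a + b))"
        by (simp add: mult.assoc)
      also have "\<dots> = (\<integral>\<^sup>+x. \<integral>\<^sup>+m. f (x * m) \<partial>distr \<Omega> borel M_X \<partial>gamma_law a)"
        using a b by (intro gamma_times_beta) measurable
      also have "\<dots> = (\<integral>\<^sup>+z. f z \<partial>?L)"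
        by (rule nn_integral_mult_pair[OF p(1), symmetric]) auto
      finally show "(\<integral>\<^sup>+z. f z \<partial>?L) = (\<integral>\<^sup>+z. f z \<partial>?R)" by simp
    qed simp_all
    then show ?thesis
      unfolding distr_mult_indep[OF assms(20)] distr_mult_indep[OF assms(23)] assms(19,22) a_def .
  qed
  have "GGC (\<theta> * \<sigma>) ?F = distr \<Omega> borel (\<lambda>\<omega>. G_\<theta>\<sigma> \<omega> * M_X \<omega>)"
    using assms a F by (intro GGC_eq) (auto simp: a_def)
  moreover have "GGC \<theta> ?F' = distr \<Omega> borel (\<lambda>\<omega>. G_\<theta> \<omega> * M_XY \<omega>)"
    using assms F' by (intro GGC_eq) auto
  ultimately show ?thesis
    using iii i unfolding distr_mult_indep[OF assms(16)] distr_mult_indep[OF assms(17)] assms(15) M_Y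
    by (simp add: a_def b_def)
qed

end
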